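(* Let $(M,g)$ be an $N$-dimensional spherically symmetric Riemannian manifold ($N\ge2$) with radius $R=\infty$ and warping function $\phi$, and let $p\ge1$ be real. Assume that $$C_\phi:=\inf_{0<r\le t}\frac{\phi(t)}{\phi(r)}>0.$$ For each $u\in W^{1,p}_{\mathrm{rad}}(M)$, it holds $$|u(x)|\le\left(\frac{p}{C_\phi^{N-1}\omega_{N-1}}\right)^{\frac1p}\|u\|_{L^p(M)}^{\frac{p-1}{p}}\|\nabla u\|_{L^p(M)}^{\frac1p}\,\phi^{\frac{1-N}{p}}(r),\qquad\text{a.e. }x=(r,\theta)\in M.$$
   Context: A spherically symmetric Riemannian manifold $(M,g)$ of dimension $N\ge2$ is one such that (1) a single chart covers $M$, with image a ball $B_R=\{x\in\mathbb R^N:|x|<R\}$, $R\in(0,\infty]$ ($B_\infty=\mathbb R^N$); the point $o\in M$ corresponding to $0$ is the origin; (2) in polar coordinates $(r,\theta)$ of this chart, $g=\mathrm dr^2+\phi^2(r)\widetilde g$ where $\widetilde g$ is the standard metric of $\mathbb S^{N-1}$ and $\phi$ (the warping function) is a nonnegative smooth function on $[0,R)$, positive on $(0,R)$, with $\phi'(0)=1$ and $\phi^{(i)}(0)=0$ for all even $i\ge0$. One identifies $M\setminus\{o\}=(0,R)\times\mathbb S^{N-1}$. A function $u\colon M\to\mathbb R$ is radial if there is $v\colon(0,R)\to\mathbb R$ with $u(x)=v(r)$ for all $x=(r,\theta)\in M\setminus\{o\}$. $W^{1,p}(M)$ is the completion of $\{u\in C^\infty(M):\int_M|u|^p\,\mathrm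 dV_g+\int_M|\nabla u|_g^p\,\mathrm dV_g<\infty\}$ under $\|u\|_{L^p(M)}+\|\nabla u\|_{L^p(M)}$, where $\|\nabla u\|_{L^p(M)}=(\int_M|\nabla u|_g^p\,\mathrm dV_g)^{1/p}$; it is regarded as a subspace of $L^p(M)$. $W^{1,p}_{\mathrm{rad}}(M)$ is the subspace of radial functions. $\omega_{N-1}$ is the $(N-1)$-dimensional volume of the unit sphere $\mathbb S^{N-1}$. For $p=1$ the factor $\|u\|_{L^p(M)}^{(p-1)/p}$ is $1$. *)

theory Defs
  imports "HOL-Analysis.Analysis"
begin

text \<open>
  The manifold of radius \<open>R = \<infinity>\<close> is identified with the image \<open>\<real>\<^sup>N\<close> of its single chart, with
  \<open>N = CARD('n)\<close> and origin \<open>0\<close>; tangent vectors are written in Cartesian coordinates.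
\<close>

section \<open>Warping functions\<close>

definition halfline_deriv :: "(real \<Rightarrow> real) \<Rightarrow> real \<Rightarrow> real" where
  "halfline_deriv f r = vector_derivative f (at r within {0..})"

definition warping_function :: "(real \<Rightarrow> real) \<Rightarrow> bool" where
  "warping_function \<phi> \<longleftrightarrow>
     (\<forall>i. \<forall>r\<ge>0. (halfline_deriv ^^ i) \<phi> differentiable (at r within {0..})) \<and>
     (\<forall>r\<ge>0. \<phi> r \<ge> 0) \<and> (\<forall>r>0. \<phi> r > 0) \<and>
     halfline_deriv \<phi> 0 = 1 \<and>
     (\<forall>i. even i \<longrightarrow> (halfline_deriv ^^ i) \<phi> 0 = 0)"

definition warping_const :: "(real \<Rightarrow> real) \<Rightarrow> real" where
  "warping_const \<phi> = (INF (r, t) \<in> {(r, t). 0 < r \<and> r \<le> t}. \<phi> t / \<phi> r)"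

section \<open>The Riemannian structure\<close>

text \<open>
  For \<open>r = norm x\<close> and \<open>\<theta> = x / norm x = sgn x\<close>, these are the differentials of \<open>r\<close> and \<open>\<theta>\<close> at
  \<open>x \<noteq> 0\<close> applied to \<open>v\<close>; the latter is tangent to the unit sphere, whose standard metric is
  the restriction of the Euclidean inner product.
\<close>

definition d_r :: "'a::euclidean_space \<Rightarrow> 'a \<Rightarrow> real" where
  "d_r x v = v \<bullet> sgn x"

definition d_theta :: "'a::euclidean_space \<Rightarrow> 'a \<Rightarrow> 'a" where
  "d_theta x v = (v - (v \<bullet> sgn x) *\<^sub>R sgn x) /\<^sub>R norm x"

text \<open>\<open>dr\<^sup>2 + \<phi>(r)\<^sup>2 g\<close> with \<open>g\<close> the metric of the sphere; since \<open>\<phi>(r) / r \<rightarrow> 1\<close> as \<open>r \<rightarrow> 0\<close>, its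
  continuous extension to the origin is Euclidean.\<close>

definition metric :: "(real \<Rightarrow> real) \<Rightarrow> 'a::euclidean_space \<Rightarrow> 'a \<Rightarrow> 'a \<Rightarrow> real" where
  "metric \<phi> x v w =
     (if x = 0 then v \<bullet> w
      else d_r x v * d_r x w + (\<phi> (norm x))\<^sup>2 * (d_theta x v \<bullet> d_theta x w))"

definition metric_norm :: "(real \<Rightarrow> real) \<Rightarrow> 'a::euclidean_space \<Rightarrow> 'a \<Rightarrow> real" where
  "metric_norm \<phi> x v = sqrt (metric \<phi> x v v)"

definition riem_vol :: "(real \<Rightarrow> real) \<Rightarrow> (real ^ 'n) measure" where
  "riem_vol \<phi> = density lebesgue
     (\<lambda>x. ennreal (sqrt (det (\<chi> i j. metric \<phi> x (axis i 1) (axis j 1)))))"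

definition riem_grad :: "(real \<Rightarrow> real) \<Rightarrow> ('a::euclidean_space \<Rightarrow> real) \<Rightarrow> 'a \<Rightarrow> 'a" where
  "riem_grad \<phi> u x = (THE w. \<forall>v. metric \<phi> x w v = frechet_derivative u (at x) v)"

section \<open>Lebesgue and Sobolev spaces\<close>

definition Lp_space :: "(real \<Rightarrow> real) \<Rightarrow> real \<Rightarrow> (real ^ 'n \<Rightarrow> real) set" where
  "Lp_space \<phi> p =
     {u \<in> borel_measurable (riem_vol \<phi>). integrable (riem_vol \<phi>) (\<lambda>x. \<bar>u x\<bar> powr p)}"

definition Lp_norm :: "(real \<Rightarrow> real) \<Rightarrow> real \<Rightarrow> (real ^ 'n \<Rightarrow> real) \<Rightarrow> real" where
  "Lp_norm \<phi> p u = (LINT x|riem_vol \<phi>. \<bar>u x\<bar> powr p) powr (1 / p)"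

definition Lp_fields :: "(real \<Rightarrow> real) \<Rightarrow> real \<Rightarrow> (real ^ 'n \<Rightarrow> real ^ 'n) set" where
  "Lp_fields \<phi> p =
     {G \<in> borel_measurable (riem_vol \<phi>).
        integrable (riem_vol \<phi>) (\<lambda>x. metric_norm \<phi> x (G x) powr p)}"

definition Lp_field_norm :: "(real \<Rightarrow> real) \<Rightarrow> real \<Rightarrow> (real ^ 'n \<Rightarrow> real ^ 'n) \<Rightarrow> real" where
  "Lp_field_norm \<phi> p G = (LINT x|riem_vol \<phi>. metric_norm \<phi> x (G x) powr p) powr (1 / p)"

primrec C_k :: "nat \<Rightarrow> ('a::euclidean_space \<Rightarrow> real) \<Rightarrow> bool" where
  "C_k 0 u \<longleftrightarrow> continuous_on UNIV u"
| "C_k (Suc k) u \<longleftrightarrow>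
     (\<forall>x. u differentiable (at x)) \<and> (\<forall>v. C_k k (\<lambda>x. frechet_derivative u (at x) v))"

definition smooth_W1p :: "(real \<Rightarrow> real) \<Rightarrow> real \<Rightarrow> (real ^ 'n \<Rightarrow> real) set" where
  "smooth_W1p \<phi> p =
     {u. (\<forall>k. C_k k u) \<and> u \<in> Lp_space \<phi> p \<and> riem_grad \<phi> u \<in> Lp_fields \<phi> p}"

definition W1p_norm :: "(real \<Rightarrow> real) \<Rightarrow> real \<Rightarrow> (real ^ 'n \<Rightarrow> real) \<Rightarrow> real" where
  "W1p_norm \<phi> p u = Lp_norm \<phi> p u + Lp_field_norm \<phi> p (riem_grad \<phi> u)"

text \<open>
  The sequence \<open>U\<close> represents an element of the completion of \<open>smooth_W1p \<phi> p\<close>, and \<open>u\<close> is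
  (a representative of) the element of \<open>L\<^sup>p\<close> with which it is identified.
\<close>

definition W1p_represents ::
  "(real \<Rightarrow> real) \<Rightarrow> real \<Rightarrow> (nat \<Rightarrow> real ^ 'n \<Rightarrow> real) \<Rightarrow> (real ^ 'n \<Rightarrow> real) \<Rightarrow> bool" where
  "W1p_represents \<phi> p U u \<longleftrightarrow>
     (\<forall>n. U n \<in> smooth_W1p \<phi> p) \<and>
     (\<forall>e>0. \<exists>K. \<forall>m\<ge>K. \<forall>n\<ge>K. W1p_norm \<phi> p (\<lambda>x. U m x - U n x) < e) \<and>
     u \<in> Lp_space \<phi> p \<and>
     (\<lambda>n. Lp_norm \<phi> p (\<lambda>x. U n x - u x)) \<longlonglongrightarrow> 0"

definition W1p :: "(real \<Rightarrow> real) \<Rightarrow> real \<Rightarrow> (real ^ 'n \<Rightarrow> real) set" where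
  "W1p \<phi> p = {u. \<exists>U. W1p_represents \<phi> p U u}"

text \<open>
  \<open>G\<close> is (a representative of) the gradient of \<open>u \<in> W1p \<phi> p\<close>, that is, the \<open>L\<^sup>p\<close> limit of the
  gradients of a representing sequence. It exists because the \<open>L\<^sup>p\<close> vector fields form a complete
  space.
\<close>

definition has_W1p_grad ::
  "(real \<Rightarrow> real) \<Rightarrow> real \<Rightarrow> (real ^ 'n \<Rightarrow> real) \<Rightarrow> (real ^ 'n \<Rightarrow> real ^ 'n) \<Rightarrow> bool" where
  "has_W1p_grad \<phi> p u G \<longleftrightarrow>
     G \<in> Lp_fields \<phi> p \<and>
     (\<exists>U. W1p_represents \<phi> p U u \<and>
        (\<lambda>n. Lp_field_norm \<phi> p (\<lambda>x. riem_grad \<phi> (U n) x - G x)) \<longlonglongrightarrow> 0)"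

definition radial :: "('a::real_normed_vector \<Rightarrow> real) \<Rightarrow> bool" where
  "radial u \<longleftrightarrow> (\<exists>v. \<forall>x. x \<noteq> 0 \<longrightarrow> u x = v (norm x))"

definition W1p_rad :: "(real \<Rightarrow> real) \<Rightarrow> real \<Rightarrow> (real ^ 'n \<Rightarrow> real) set" where
  "W1p_rad \<phi> p = {u \<in> W1p \<phi> p. radial u}"

section \<open>Volume of the unit sphere\<close>

text \<open>
  Surface measure on the unit sphere, normalised so that the Lebesgue measure of the cone
  \<open>{t x | 0 < t \<le> 1, x \<in> A}\<close> is \<open>\<integral>\<^sub>0\<^sup>1 t\<^bsup>N-1\<^esup> dt = 1/N\<close> times the surface measure of \<open>A\<close>.
\<close>

definition sphere_measure :: "'a::euclidean_space set \<Rightarrow> real" where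
  "sphere_measure A =
     real DIM('a) * measure lebesgue {t *\<^sub>R x | t x. 0 < t \<and> t \<le> 1 \<and> x \<in> A}"

definition sphere_volume :: "'a::euclidean_space itself \<Rightarrow> real" where
  "sphere_volume _ = sphere_measure (sphere (0::'a) 1)"

end

theory Submission
  imports Defs
begin

text \<open>
  For smooth \<open>U\<close> (radial or not) and almost every direction \<open>\<theta>\<close>, the fundamental theorem of calculus
  along the ray gives \<open>\<bar>U(t\<theta>)\<bar>\<^sup>p \<le> p \<integral>\<^sub>t\<^sup>\<infinity> \<bar>U\<bar>\<^bsup>p-1\<^esup> \<bar>\<partial>\<^sub>r U\<bar> ds\<close>: there is no boundary term at infinity, since
  \<open>\<phi>\<close> is bounded below there and \<open>\<bar>U\<bar>\<^sup>p \<phi>\<^bsup>N-1\<^esup>\<close> is integrable along the ray. Multiply by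
  \<open>(C \<phi>(t))\<^bsup>N-1\<^esup> \<le> \<phi>(s)\<^bsup>N-1\<^esup>\<close>, integrate over the sphere and apply Hoelder: this bounds the spherical
  mean of \<open>\<bar>U\<bar>\<^sup>p\<close> at every radius by the norms of \<open>U\<close> and its gradient. For a sequence representing a
  radial \<open>u\<close>, Fatou's lemma on almost every sphere carries the bound over to \<open>u\<close>, where the mean
  of \<open>\<bar>u\<bar>\<^sup>p\<close> is its value. So the approximating functions need not be made radial.
\<close>

section \<open>Polar coordinates\<close>

lemma borel_measurable_sgn [measurable]: "sgn \<in> borel_measurable (borel :: 'a::euclidean_space measure)"
proof -
  have "sgn = (\<lambda>x::'a. x /\<^sub>R norm x)" by (simp add: fun_eq_iff sgn_div_norm)
  then show ?thesis by simp
qed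

lemma pred_cball [measurable]:
  "g \<in> borel_measurable M \<Longrightarrow> Measurable.pred M (\<lambda>x. g x \<in> cball (0 :: 'a::euclidean_space) r)"
  by simp

text \<open>The endpoint may depend on the other variable: this makes
  \<open>indicator {norm y..} s\<close> jointly measurable in \<open>s\<close> and \<open>y\<close>,
  as Tonelli's theorem requires.\<close>

lemma pred_atLeast [measurable]:
  fixes g h :: "'a \<Rightarrow> real"
  shows "g \<in> borel_measurable M \<Longrightarrow> h \<in> borel_measurable M \<Longrightarrow> Measurable.pred M (\<lambda>x. g x \<in> {h x..})"
  by simp

lemma nn_integral_lborel_scale:
  fixes f :: "'a::euclidean_space \<Rightarrow> ennreal"
  assumes [measurable]: "f \<in> borel_measurable borel" and c: "c > 0"
  shows "(\<integral>\<^sup>+x. f x \<partial>lborel) = ennreal (c ^ DIM('a)) * (\<integral>\<^sup>+x. f (c *\<^sub>R x) \<partial>lborel)"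
  using c by (subst lborel_affine[of c 0])
    (simp_all add: nn_integral_density nn_integral_distr nn_integral_cmult)

lemma nn_integral_power_tail:
  fixes a :: real
  assumes a: "a > 0" and n: "n > 0"
  shows "(\<integral>\<^sup>+s. ennreal (1 / s ^ Suc n) * indicator {a..} s \<partial>lborel) = ennreal (1 / (real n * a ^ n))"
proof -
  have "(\<integral>\<^sup>+s. ennreal (1 / s ^ Suc n) * indicator {a..} s \<partial>lborel) = 0 - (- (1 / (real n * a ^ n)))"
  proof (rule nn_integral_FTC_atLeast)
    show "((\<lambda>s. - (1 / (real n * s ^ n))) \<longlongrightarrow> 0) at_top"
      using tendsto_minus[OF tendsto_divide_0[OF tendsto_const[of 1], OF filterlim_at_top_imp_at_infinity[OF
            filterlim_tendsto_pos_mult_at_top[OF tendsto_const[of "real n"] _ filterlim_pow_at_top[OF n filterlim_ident]]]]] n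
      by simp
    fix x assume "a \<le> x"
    then have x: "x > 0" using a by simp
    have "((\<lambda>s. - inverse (real n) * inverse s ^ n) has_real_derivative
        - inverse (real n) * (real n * inverse x ^ (n - 1) * (- (inverse x * 1 * inverse x)))) (at x)"
      using x by (auto intro!: derivative_eq_intros)
    moreover have "- inverse (real n) * (real n * inverse x ^ (n - 1) * (- (inverse x * 1 * inverse x))) = 1 / x ^ Suc n"
      using n by (cases n) (simp_all add: divide_inverse power_inverse mult_ac)
    moreover have "(\<lambda>s. - inverse (real n) * inverse s ^ n) = (\<lambda>s. - (1 / (real n * s ^ n)))"
      by (simp add: fun_eq_iff divide_inverse power_inverse)
    ultimately show "((\<lambda>s. - (1 / (real n * s ^ n))) has_real_derivative 1 / x ^ Suc n) (at x)"
      by simp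
  qed (use a in auto)
  then show ?thesis by simp
qed

text \<open>The value is independent of \<open>r\<close>; with \<open>r = norm y\<close> it yields
  the constant \<open>1 / N\<close> in the polar formula, \<open>N\<close> being the
  dimension.\<close>

lemma nn_integral_scaled_power_tail:
  fixes r :: real
  assumes r: "r > 0" and n: "n > 0"
  shows "(\<integral>\<^sup>+s. ennreal (r ^ n) * (ennreal (1 / s ^ Suc n) * indicator {r..} s) \<partial>lborel) = ennreal (1 / real n)"
  using assms
  using nn_integral_power_tail[OF assms]
  by (subst nn_integral_cmult) (auto simp flip: ennreal_mult)

text \<open>Substitution \<open>t = norm x * s\<close>. It replaces the unit vector
  \<open>sgn x\<close> by \<open>x\<close> itself, so that for fixed \<open>s\<close> the function
  \<open>f\<close> is evaluated at a dilation of \<open>x\<close>.\<close>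

lemma nn_integral_ray_scale:
  fixes f :: "'a::euclidean_space \<Rightarrow> ennreal"
  assumes [measurable]: "f \<in> borel_measurable borel" and x: "x \<noteq> 0" and n: "n > 0"
  shows "(\<integral>\<^sup>+t. indicator {0<..} t * ennreal (t ^ (n - 1)) * f (t *\<^sub>R sgn x) \<partial>lborel) =
    (\<integral>\<^sup>+s. indicator {0<..} s * ennreal (s ^ (n - 1) * norm x ^ n) * f (s *\<^sub>R x) \<partial>lborel)"
proof -
  have "(\<integral>\<^sup>+t. indicator {0<..} t * ennreal (t ^ (n - 1)) * f (t *\<^sub>R sgn x) \<partial>lborel) =
    norm x * (\<integral>\<^sup>+s. indicator {0<..} (norm x * s) * ennreal ((norm x * s) ^ (n - 1)) * f ((norm x * s) *\<^sub>R sgn x) \<partial>lborel)"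
    using x by (subst nn_integral_real_affine[where c="norm x" and t=0]) auto
  also have "\<dots> = (\<integral>\<^sup>+s. indicator {0<..} s * ennreal (s ^ (n - 1) * norm x ^ n) * f (s *\<^sub>R x) \<partial>lborel)"
  proof (subst nn_integral_cmult[symmetric], simp, rule nn_integral_cong)
    fix s :: real
    show "ennreal (norm x) * (indicator {0<..} (norm x * s) * ennreal ((norm x * s) ^ (n - 1)) * f ((norm x * s) *\<^sub>R sgn x)) =
      indicator {0<..} s * ennreal (s ^ (n - 1) * norm x ^ n) * f (s *\<^sub>R x)"
    proof (cases "s > 0")
      case True
      have "ennreal (norm x) * ennreal ((norm x * s) ^ (n - 1)) = ennreal (s ^ (n - 1) * norm x ^ n)"
        using n True by (cases n) (auto simp: power_mult_distrib mult_ac simp flip: ennreal_mult)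
      moreover have "(norm x * s) *\<^sub>R sgn x = s *\<^sub>R x"
        using x by (simp add: sgn_div_norm)
      ultimately show ?thesis using True x by (simp add: mult.assoc[symmetric])
    next
      case False
      then show ?thesis using x by (simp add: zero_less_mult_iff)
    qed
  qed
  finally show ?thesis .
qed

text \<open>
  The integral over the sphere is \<open>N\<close> times the integral over the unit ball of the function extended
  to be constant along rays; by scaling and Tonelli no surface measure is needed.
\<close>

lemma nn_integral_polar:
  fixes f :: "'a::euclidean_space \<Rightarrow> ennreal"
  assumes f[measurable]: "f \<in> borel_measurable borel"
  shows "(\<integral>\<^sup>+x. f x \<partial>lborel) = ennreal (real DIM('a)) *
    (\<integral>\<^sup>+x\<in>cball 0 1. (\<integral>\<^sup>+t. indicator {0<..} t * ennreal (t ^ (DIM('a) - 1)) * f (t *\<^sub>R sgn x) \<partial>lborel) \<partial>lborel)"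
    (is "_ = _ * ?R")
proof -
  let ?n = "DIM('a)"
  \<comment> \<open>The integrand after substituting \<open>y = s *\<^sub>R x\<close> at fixed
    \<open>s\<close>: the condition \<open>norm x \<le> 1\<close> becomes
    \<open>norm y \<le> s\<close>, and the Jacobian \<open>1 / s ^ ?n\<close> together with the
    rescaled \<open>norm x ^ ?n\<close> leaves the exponent \<open>Suc ?n\<close>.\<close>
  let ?g = "\<lambda>s y. indicator {norm y..} s * indicator {0<..} s * ennreal (1 / s ^ Suc ?n * norm y ^ ?n) * f y"
  have "?R = (\<integral>\<^sup>+x. (\<integral>\<^sup>+s. indicator (cball 0 1) x * (indicator {0<..} s *
      ennreal (s ^ (?n - 1) * norm x ^ ?n) * f (s *\<^sub>R x)) \<partial>lborel) \<partial>lborel)"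
  proof (rule nn_integral_cong_AE, rule AE_mp[OF AE_lborel_singleton[of 0]], rule AE_I2, rule impI)
    fix x :: 'a assume "x \<noteq> 0"
    then show "(\<integral>\<^sup>+t. indicator {0<..} t * ennreal (t ^ (?n - 1)) * f (t *\<^sub>R sgn x) \<partial>lborel) * indicator (cball 0 1) x =
      (\<integral>\<^sup>+s. indicator (cball 0 1) x * (indicator {0<..} s * ennreal (s ^ (?n - 1) * norm x ^ ?n) * f (s *\<^sub>R x)) \<partial>lborel)"
      by (subst nn_integral_cmult, simp, subst nn_integral_ray_scale) (auto simp: mult_ac)
  qed
  also have "\<dots> = (\<integral>\<^sup>+s. (\<integral>\<^sup>+x. indicator (cball 0 1) x * (indicator {0<..} s *
      ennreal (s ^ (?n - 1) * norm x ^ ?n) * f (s *\<^sub>R x)) \<partial>lborel) \<partial>lborel)"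
    by (rule lborel_pair.Fubini') measurable
  also have "\<dots> = (\<integral>\<^sup>+s. (\<integral>\<^sup>+y. ?g s y \<partial>lborel) \<partial>lborel)"
  proof (rule nn_integral_cong)
    fix s :: real
    show "(\<integral>\<^sup>+x. indicator (cball 0 1) x * (indicator {0<..} s * ennreal (s ^ (?n - 1) * norm x ^ ?n) * f (s *\<^sub>R x)) \<partial>lborel)
      = (\<integral>\<^sup>+y. ?g s y \<partial>lborel)"
    proof (cases "s > 0")
      case s: True
      have "(\<integral>\<^sup>+y. ?g s y \<partial>lborel) = ennreal (s ^ ?n) * (\<integral>\<^sup>+x. ?g s (s *\<^sub>R x) \<partial>lborel)"
        by (rule nn_integral_lborel_scale[OF _ s]) measurable
      also have "\<dots> = (\<integral>\<^sup>+x. ennreal (s ^ ?n) * ?g s (s *\<^sub>R x) \<partial>lborel)"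
        by (rule nn_integral_cmult[symmetric]) measurable
      finally show ?thesis
      proof (elim ssubst, intro nn_integral_cong)
        fix x :: 'a
        have w: "ennreal (s ^ ?n) * ennreal (1 / s ^ Suc ?n * norm (s *\<^sub>R x) ^ ?n) = ennreal (s ^ (?n - 1) * norm x ^ ?n)" (is "?w1 = _")
        proof -
          have "s ^ ?n * (1 / s ^ Suc ?n * norm (s *\<^sub>R x) ^ ?n) = s ^ (?n - 1) * norm x ^ ?n"
            using s by (cases ?n) (auto simp: power_mult_distrib field_simps)
          then show ?thesis using s by (simp flip: ennreal_mult)
        qed
        have i: "indicator {norm (s *\<^sub>R x)..} s = (indicator (cball 0 1) x :: ennreal)"
          using s by (auto simp: indicator_def)
        have "ennreal (s ^ ?n) * ?g s (s *\<^sub>R x) = indicator {norm (s *\<^sub>R x)..} s * (indicator {0<..} s * ?w1 * f (s *\<^sub>R x))"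
          by (simp only: mult_ac)
        then show "indicator (cball 0 1) x * (indicator {0<..} s * ennreal (s ^ (?n - 1) * norm x ^ ?n) * f (s *\<^sub>R x)) =
          ennreal (s ^ ?n) * ?g s (s *\<^sub>R x)"
          by (simp only: w i)
      qed
    qed simp
  qed
  also have "\<dots> = (\<integral>\<^sup>+y. (\<integral>\<^sup>+s. ?g s y \<partial>lborel) \<partial>lborel)"
    by (rule lborel_pair.Fubini'[symmetric]) measurable
  \<comment> \<open>For fixed \<open>y\<close> the integral over \<open>s\<close> is a power tail
    starting at \<open>norm y\<close>, equal to \<open>1 / ?n\<close>; the point
    \<open>y = 0\<close>, where the tail would start at 0, is a null set.\<close>
  also have "\<dots> = (\<integral>\<^sup>+y. ennreal (1 / real ?n) * f y \<partial>lborel)"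
  proof (rule nn_integral_cong_AE, rule AE_mp[OF AE_lborel_singleton[of 0]], rule AE_I2, rule impI)
    fix y :: 'a assume y: "y \<noteq> 0"
    have "(\<integral>\<^sup>+s. ?g s y \<partial>lborel) =
      (\<integral>\<^sup>+s. (ennreal (norm y ^ ?n) * (ennreal (1 / s ^ Suc ?n) * indicator {norm y..} s)) * f y \<partial>lborel)"
    proof (rule nn_integral_cong)
      fix s :: real
      show "?g s y = (ennreal (norm y ^ ?n) * (ennreal (1 / s ^ Suc ?n) * indicator {norm y..} s)) * f y"
      proof (cases "s \<ge> norm y")
        case True
        then have "s > 0" using y by (smt (verit) zero_less_norm_iff)
        then show ?thesis using True by (simp add: mult_ac flip: ennreal_mult)
      qed simp
    qed
    also have "\<dots> = ennreal (1 / real ?n) * f y"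
      using y by (subst nn_integral_multc, measurable) (subst nn_integral_scaled_power_tail, simp_all)
    finally show "(\<integral>\<^sup>+s. ?g s y \<partial>lborel) = ennreal (1 / real ?n) * f y" .
  qed
  also have "\<dots> = ennreal (1 / real ?n) * (\<integral>\<^sup>+y. f y \<partial>lborel)"
    by (rule nn_integral_cmult) simp
  finally show ?thesis
    by (simp add: mult.assoc[symmetric] flip: ennreal_mult)
qed

text \<open>Tonelli with the radius outermost, for statements about one sphere at a time.\<close>

lemma nn_integral_polar':
  fixes f :: "'a::euclidean_space \<Rightarrow> ennreal"
  assumes f[measurable]: "f \<in> borel_measurable borel"
  shows "(\<integral>\<^sup>+x. f x \<partial>lborel) = ennreal (real DIM('a)) *
    (\<integral>\<^sup>+t. indicator {0<..} t * ennreal (t ^ (DIM('a) - 1)) * (\<integral>\<^sup>+x\<in>cball 0 1. f (t *\<^sub>R sgn x) \<partial>lborel) \<partial>lborel)"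
proof -
  have "(\<integral>\<^sup>+x\<in>cball 0 1. (\<integral>\<^sup>+t. indicator {0<..} t * ennreal (t ^ (DIM('a) - 1)) * f (t *\<^sub>R sgn x) \<partial>lborel) \<partial>lborel)
    = (\<integral>\<^sup>+x. (\<integral>\<^sup>+t. indicator {0<..} t * ennreal (t ^ (DIM('a) - 1)) * (f (t *\<^sub>R sgn x) * indicator (cball 0 1) x) \<partial>lborel) \<partial>(lborel :: 'a measure))"
    by (subst nn_integral_multc[symmetric]) (auto simp: mult_ac)
  also have "\<dots> = (\<integral>\<^sup>+t. (\<integral>\<^sup>+x. indicator {0<..} t * ennreal (t ^ (DIM('a) - 1)) * (f (t *\<^sub>R sgn x) * indicator (cball 0 1) x) \<partial>(lborel :: 'a measure)) \<partial>lborel)"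
    by (rule lborel_pair.Fubini') measurable
  also have "\<dots> = (\<integral>\<^sup>+t. indicator {0<..} t * ennreal (t ^ (DIM('a) - 1)) * (\<integral>\<^sup>+x\<in>cball 0 1. f (t *\<^sub>R sgn (x::'a)) \<partial>lborel) \<partial>lborel)"
    by (subst nn_integral_cmult) auto
  finally show ?thesis by (subst nn_integral_polar[OF f]) simp
qed

section \<open>Null sets in polar coordinates\<close>

text \<open>The polar integral of the indicator of a null set is 0, and the weight is positive for
  \<open>t > 0\<close>; hence almost every sphere meets the set in a null set of directions.
  Directions are measured by the ball, a point \<open>x\<close> standing for
  \<open>sgn x\<close>.\<close>

lemma AE_sphere_of_AE:
  fixes P :: "'a::euclidean_space \<Rightarrow> bool"
  assumes "AE x in lborel. P x"
  shows "AE t in lborel. t > 0 \<longrightarrow> (AE x in lborel. x \<in> cball 0 1 \<longrightarrow> P (t *\<^sub>R sgn x))"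
proof -
  from assms obtain Z where Z: "{x. \<not> P x} \<subseteq> Z" "emeasure lborel Z = 0" and [measurable]: "Z \<in> sets borel"
    by (auto elim!: AE_E)
  define g :: "'a \<Rightarrow> ennreal" where "g = indicator Z"
  have [measurable]: "g \<in> borel_measurable borel" by (simp add: g_def)
  have "(\<integral>\<^sup>+x. g x \<partial>(lborel :: 'a measure)) = 0" using Z by (simp add: g_def)
  then have "(\<integral>\<^sup>+t. indicator {0<..} t * ennreal (t ^ (DIM('a) - 1)) * (\<integral>\<^sup>+x\<in>cball 0 1. g (t *\<^sub>R sgn (x::'a)) \<partial>lborel) \<partial>lborel) = 0"
    by (subst (asm) nn_integral_polar') auto
  then have ae: "AE t in lborel. indicator {0<..} t * ennreal (t ^ (DIM('a) - 1)) * (\<integral>\<^sup>+x\<in>cball 0 1. g (t *\<^sub>R sgn (x::'a)) \<partial>lborel) = 0"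
    by (subst (asm) nn_integral_0_iff_AE) auto
  have *: "AE x in lborel. x \<in> cball 0 1 \<longrightarrow> P (t *\<^sub>R sgn x)"
    if "indicator {0<..} t * ennreal (t ^ (DIM('a) - 1)) * (\<integral>\<^sup>+x\<in>cball 0 1. g (t *\<^sub>R sgn (x::'a)) \<partial>lborel) = 0"
      and "t > 0" for t :: real
  proof -
    from that have "(\<integral>\<^sup>+x\<in>cball 0 1. g (t *\<^sub>R sgn (x::'a)) \<partial>lborel) = 0"
      by auto
    then have "AE x in lborel. g (t *\<^sub>R sgn (x::'a)) * indicator (cball 0 1) x = (0::ennreal)"
      by (subst (asm) nn_integral_0_iff_AE) auto
    then show "AE x in lborel. x \<in> cball 0 1 \<longrightarrow> P (t *\<^sub>R sgn x)"
      by (rule AE_mp) (use Z(1) in \<open>auto simp: g_def indicator_def split: if_splits\<close>)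
  qed
  show ?thesis
    by (rule eventually_mono[OF ae]) (use * in blast)
qed

text \<open>The opposite direction: for a radius outside the null set \<open>Z\<close> the inner
  polar integral vanishes, so the points with \<open>norm x\<close> in \<open>Z\<close> form a null
  set.\<close>

lemma AE_norm_of_AE:
  assumes "AE t in lborel. P t"
  shows "AE x in (lborel :: 'a::euclidean_space measure). P (norm x)"
proof -
  from assms obtain Z where Z: "{x. \<not> P x} \<subseteq> Z" "emeasure lborel Z = 0" and [measurable]: "Z \<in> sets borel"
    by (auto elim!: AE_E)
  let ?n = "DIM('a)"
  have nz: "AE t in lborel. t \<notin> Z" using Z by (intro AE_not_in) (auto simp: null_sets_def)
  have "(\<integral>\<^sup>+x. indicator Z (norm x) \<partial>(lborel :: 'a measure)) = ennreal (real ?n) *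
    (\<integral>\<^sup>+t. indicator {0<..} t * ennreal (t ^ (?n - 1)) * (\<integral>\<^sup>+x\<in>cball 0 1. indicator Z (norm (t *\<^sub>R sgn (x::'a))) \<partial>lborel) \<partial>lborel)"
    by (rule nn_integral_polar') simp
  also have "(\<integral>\<^sup>+t. indicator {0<..} t * ennreal (t ^ (?n - 1)) * (\<integral>\<^sup>+x\<in>cball 0 1. indicator Z (norm (t *\<^sub>R sgn (x::'a))) \<partial>lborel) \<partial>lborel) = (\<integral>\<^sup>+t. 0 \<partial>(lborel::real measure))"
  proof (rule nn_integral_cong_AE, rule AE_mp[OF nz], intro AE_I2 impI)
    fix t :: real assume t: "t \<notin> Z"
    show "indicator {0<..} t * ennreal (t ^ (?n - 1)) * (\<integral>\<^sup>+x\<in>cball 0 1. indicator Z (norm (t *\<^sub>R sgn (x::'a))) \<partial>lborel) = 0"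
    proof (cases "t > 0")
      case True
      have "(\<integral>\<^sup>+x\<in>cball 0 1. indicator Z (norm (t *\<^sub>R sgn (x::'a))) \<partial>lborel) = (\<integral>\<^sup>+x. 0 \<partial>(lborel :: 'a measure))"
        by (rule nn_integral_cong_AE, rule AE_mp[OF AE_lborel_singleton[of 0]])
           (use t True in \<open>auto simp: norm_sgn\<close>)
      then show ?thesis by simp
    qed simp
  qed
  finally have "(\<integral>\<^sup>+x. indicator Z (norm x) \<partial>(lborel :: 'a measure)) = 0"
    by simp
  then have "AE x in (lborel :: 'a measure). indicator Z (norm x) = (0::ennreal)"
    by (subst (asm) nn_integral_0_iff_AE) auto
  then show ?thesis
    by (rule AE_mp) (use Z(1) in \<open>auto simp: indicator_def split: if_splits\<close>)
qed

section \<open>The metric and its volume\<close>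

context
  fixes \<phi> :: "real \<Rightarrow> real"
  assumes warping: "warping_function \<phi>"
begin

lemma warping_pos: "r > 0 \<Longrightarrow> \<phi> r > 0"
  using warping by (simp add: warping_function_def)

lemma warping_nonneg: "r \<ge> 0 \<Longrightarrow> \<phi> r \<ge> 0"
  using warping by (simp add: warping_function_def)

lemma warping_continuous: "continuous_on {0..} \<phi>"
proof -
  have "\<phi> differentiable (at r within {0..})" if "r \<ge> 0" for r
    using warping that unfolding warping_function_def by (metis funpow_0)
  then show ?thesis
    by (auto simp: continuous_on_eq_continuous_within intro: differentiable_imp_continuous_within)
qed

text \<open>A warping function is constrained on \<open>{0..}\<close> only and may be arbitrary on
  negative arguments, hence the composition with \<open>norm\<close>. For the same reason later
  integrals over the real line contain \<open>\<phi> \<bar>t\<bar>\<close>.\<close>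

lemma warping_measurable:
  "f \<in> borel_measurable M \<Longrightarrow> (\<lambda>x. \<phi> (norm (f x :: 'a::euclidean_space))) \<in> borel_measurable M"
proof -
  have "continuous_on UNIV (\<lambda>x::'a. \<phi> (norm x))"
    by (rule continuous_on_compose2[OF warping_continuous]) (auto intro: continuous_intros)
  then have "(\<lambda>x::'a. \<phi> (norm x)) \<in> borel_measurable borel"
    by (rule borel_measurable_continuous_onI)
  then show "f \<in> borel_measurable M \<Longrightarrow> (\<lambda>x. \<phi> (norm (f x :: 'a))) \<in> borel_measurable M"
    by (rule measurable_compose[rotated])
qed

lemma warping_const_le:
  assumes "0 < r" "r \<le> t"
  shows "warping_const \<phi> * \<phi> r \<le> \<phi> t"
proof -
  have "warping_const \<phi> \<le> (case (r, t) of (r, t) \<Rightarrow> \<phi> t / \<phi> r)"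
    unfolding warping_const_def
  proof (rule cINF_lower)
    \<comment> \<open>A real infimum is a lower bound only if the set is bounded below; here the
      ratios are nonnegative.\<close>
    show "bdd_below ((\<lambda>(r, t). \<phi> t / \<phi> r) ` {(r, t). 0 < r \<and> r \<le> t})"
      by (rule bdd_belowI[of _ 0]) (auto intro!: divide_nonneg_nonneg warping_nonneg)
  qed (use assms in auto)
  then show ?thesis using warping_pos[OF assms(1)] by (simp add: field_simps)
qed

text \<open>Pythagoras for the radial and tangential projections: the metric is Euclidean on the
  radial line and Euclidean times \<open>(\<phi> r / r)\<^sup>2\<close> on its orthogonal
  complement.\<close>

lemma metric_scaled:
  fixes x v w :: "'a::euclidean_space"
  assumes "x \<noteq> 0"
  shows "metric \<phi> x v w = (v \<bullet> sgn x) * (w \<bullet> sgn x) +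
    (\<phi> (norm x) / norm x)\<^sup>2 * (v \<bullet> w - (v \<bullet> sgn x) * (w \<bullet> sgn x))"
proof -
  have ss: "sgn x \<bullet> sgn x = 1" using assms by (simp add: dot_square_norm norm_sgn)
  have "(v - (v \<bullet> sgn x) *\<^sub>R sgn x) \<bullet> (w - (w \<bullet> sgn x) *\<^sub>R sgn x) = v \<bullet> w - (v \<bullet> sgn x) * (w \<bullet> sgn x)"
    by (simp add: inner_diff_left inner_diff_right ss inner_commute)
  then have "d_theta x v \<bullet> d_theta x w = (v \<bullet> w - (v \<bullet> sgn x) * (w \<bullet> sgn x)) / (norm x)\<^sup>2"
    unfolding d_theta_def by (simp add: divide_inverse power2_eq_square)
  then show ?thesis
    using assms by (simp add: metric_def d_r_def power_divide)
qed

text \<open>At a fixed point the metric norm is a product-space norm of a linear image of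
  \<open>v\<close>, so the triangle inequality and the bound on the radial component are
  inherited.\<close>

lemma metric_norm_eq_norm:
  fixes x v :: "'a::euclidean_space"
  assumes "x \<noteq> 0"
  shows "metric_norm \<phi> x v = norm (d_r x v, \<phi> (norm x) *\<^sub>R d_theta x v)"
  using assms unfolding metric_norm_def metric_def norm_Pair
  by (simp add: power2_eq_square flip: power2_norm_eq_inner)

lemma d_r_diff: "d_r x (v - w) = d_r x v - d_r x w"
  by (simp add: d_r_def inner_diff_left)

lemma d_theta_diff: "d_theta x (v - w) = d_theta x v - d_theta x w"
  by (simp add: d_theta_def inner_diff_left algebra_simps)

lemma metric_norm_triangle:
  "metric_norm \<phi> x v \<le> metric_norm \<phi> x (v - w) + metric_norm \<phi> x w"
proof (cases "x = 0")
  case True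
  then show ?thesis
    using norm_triangle_ineq[of "v - w" w] by (simp add: metric_norm_def metric_def flip: norm_eq_sqrt_inner)
next
  case False
  then show ?thesis
    using norm_triangle_ineq[of "(d_r x (v - w), \<phi> (norm x) *\<^sub>R d_theta x (v - w))" "(d_r x w, \<phi> (norm x) *\<^sub>R d_theta x w)"]
    by (simp add: metric_norm_eq_norm d_r_diff d_theta_diff algebra_simps)
qed

lemma metric_norm_minus: "metric_norm \<phi> x (- v) = metric_norm \<phi> x v"
  using d_r_diff[of x 0 v] d_theta_diff[of x 0 v]
  by (simp add: metric_norm_def metric_def d_r_def[of x 0] d_theta_def[of x 0])

lemma metric_norm_nonneg: "metric_norm \<phi> x v \<ge> 0"
  by (cases "x = 0") (simp add: metric_norm_def metric_def, simp add: metric_norm_eq_norm)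

lemma metric_norm_ge_radial:
  assumes "x \<noteq> 0"
  shows "\<bar>v \<bullet> sgn x\<bar> \<le> metric_norm \<phi> x v"
  using norm_fst_le[of "d_r x v" "\<phi> (norm x) *\<^sub>R d_theta x v"] assms
  by (simp add: metric_norm_eq_norm d_r_def)

text \<open>\<open>riem_grad\<close> is a definite description, so existence and uniqueness of the
  representing vector must be shown first. The radial direction has unit length and is orthogonal to
  the tangential ones, so the radial component agrees with the Euclidean one.\<close>

lemma riem_grad_inner_sgn:
  fixes x :: "'a::euclidean_space"
  assumes x: "x \<noteq> 0" and diff: "u differentiable (at x)"
  shows "riem_grad \<phi> u x \<bullet> sgn x = frechet_derivative u (at x) (sgn x)"
proof -
  let ?D = "frechet_derivative u (at x)" and ?s = "sgn x"
  define a where "a = (\<phi> (norm x) / norm x)\<^sup>2"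
  have a: "a > 0" using x warping_pos[of "norm x"] by (simp add: a_def)
  have ss: "?s \<bullet> ?s = 1" using x by (simp add: dot_square_norm norm_sgn)
  have lin: "linear ?D" using diff by (rule linear_frechet_derivative)
  \<comment> \<open>The Euclidean gradient.\<close>
  define e where "e = (\<Sum>b\<in>Basis. ?D b *\<^sub>R b)"
  have e: "e \<bullet> v = ?D v" for v
  proof -
    have "?D v = ?D (\<Sum>b\<in>Basis. (v \<bullet> b) *\<^sub>R b)" by (simp add: euclidean_representation)
    also have "\<dots> = (\<Sum>b\<in>Basis. (v \<bullet> b) * ?D b)"
      using lin by (simp add: linear_sum linear_cmul)
    also have "\<dots> = e \<bullet> v" by (simp add: e_def inner_sum_left inner_commute[of v] mult.commute)
    finally show ?thesis by simp
  qed
  \<comment> \<open>The metric multiplies tangential parts by \<open>a\<close>, so the tangential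
    part of \<open>e\<close> is divided by \<open>a\<close> and the radial part is kept.\<close>
  define w where "w = (e \<bullet> ?s) *\<^sub>R ?s + (1 / a) *\<^sub>R (e - (e \<bullet> ?s) *\<^sub>R ?s)"
  have m: "metric \<phi> x v z = (v \<bullet> ?s) * (z \<bullet> ?s) + a * (v \<bullet> z - (v \<bullet> ?s) * (z \<bullet> ?s))" for v z
    using metric_scaled[OF x] by (simp add: a_def)
  have ws: "w \<bullet> ?s = e \<bullet> ?s"
    by (simp add: w_def inner_add_left inner_diff_left ss)
  have "metric \<phi> x w v = ?D v" for v
  proof -
    have "a * (w \<bullet> v) = a * ((e \<bullet> ?s) * (v \<bullet> ?s)) + (e \<bullet> v - (e \<bullet> ?s) * (v \<bullet> ?s))"
      using a by (simp add: w_def inner_add_left inner_diff_left inner_commute[of ?s v] distrib_left)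
    then show ?thesis unfolding m ws e[symmetric] by (simp add: algebra_simps)
  qed
  \<comment> \<open>Uniqueness by positive definiteness: the difference of two representing vectors
    has metric length 0.\<close>
  moreover have "w' = w" if "\<forall>v. metric \<phi> x w' v = ?D v" for w'
  proof -
    let ?z = "w' - w"
    have "metric \<phi> x ?z ?z = metric \<phi> x w' ?z - metric \<phi> x w ?z"
      unfolding m by (simp add: inner_diff_left algebra_simps)
    then have "metric \<phi> x ?z ?z = 0"
      using that \<open>\<And>v. metric \<phi> x w v = ?D v\<close> by simp
    then have z: "(?z \<bullet> ?s)\<^sup>2 + a * (?z \<bullet> ?z - (?z \<bullet> ?s)\<^sup>2) = 0"
      unfolding m by (simp add: power2_eq_square)
    \<comment> \<open>The squared length of the tangential part of \<open>?z\<close>; being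
      nonnegative, it forces both summands in \<open>z\<close> to vanish.\<close>
    have "(?z - (?z \<bullet> ?s) *\<^sub>R ?s) \<bullet> (?z - (?z \<bullet> ?s) *\<^sub>R ?s) = ?z \<bullet> ?z - (?z \<bullet> ?s)\<^sup>2"
      using ss by (simp add: inner_diff_left inner_diff_right inner_commute power2_eq_square algebra_simps)
    then have "?z \<bullet> ?z - (?z \<bullet> ?s)\<^sup>2 \<ge> 0"
      by (metis inner_ge_zero)
    with z a have "(?z \<bullet> ?s)\<^sup>2 = 0" "?z \<bullet> ?z - (?z \<bullet> ?s)\<^sup>2 = 0"
      by (smt (verit) mult_pos_pos zero_le_power2 mult_nonneg_nonneg)+
    then show ?thesis by simp
  qed
  ultimately have "riem_grad \<phi> u x = w"
    unfolding riem_grad_def by (intro the_equality) auto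
  then show ?thesis using ws e by simp
qed

end

section \<open>Determinant of the metric and the volume density\<close>

text \<open>The matrix has eigenvalue 1 on the line of \<open>s\<close> and \<open>b\<close> on its
  orthogonal complement. An orthogonal \<open>Q\<close> that takes a basis vector to
  \<open>s\<close> diagonalizes it.\<close>

lemma det_scaled_rank_one:
  fixes s :: "real ^ 'n"
  assumes s: "norm s = 1"
  shows "det (\<chi> i j. b * (if i = j then 1 else 0) + (1 - b) * (s $ i * s $ j)) = b ^ (CARD('n) - 1)"
proof -
  obtain k :: 'n where True by simp
  obtain Q where Q: "orthogonal_matrix Q" "Q *v axis k 1 = s"
    using orthogonal_matrix_exists_basis[OF s] by metis
  let ?M = "(\<chi> i j. b * (if i = j then 1 else 0) + (1 - b) * (s $ i * s $ j)) :: real ^ 'n ^ 'n"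
  let ?D = "(\<chi> i j. if i = j then (if i = k then 1 else b) else 0) :: real ^ 'n ^ 'n"
  have QT: "Q ** transpose Q = mat 1" using Q(1) by (simp add: orthogonal_matrix_def)
  have Qs: "Q $ i $ k = s $ i" for i
    using Q(2) by (metis matrix_vector_mul_component matrix_vector_mult_basis column_def vec_lambda_beta)
  have "?M = Q ** ?D ** transpose Q"
  proof -
    have "?M $ i $ j = (Q ** ?D ** transpose Q) $ i $ j" for i j
    proof -
    have qt: "(\<Sum>l\<in>UNIV. Q $ i $ l * Q $ j $ l) = (if i = j then 1 else 0)"
      using arg_cong[OF QT, of "\<lambda>A. A $ i $ j"] by (simp add: matrix_matrix_mult_def transpose_def mat_def)
    have "(Q ** ?D ** transpose Q) $ i $ j = (\<Sum>l\<in>UNIV. Q $ i $ l * (if l = k then 1 else b) * Q $ j $ l)"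
    proof -
      have "(Q ** ?D) $ i $ l = Q $ i $ l * (if l = k then 1 else b)" for l
        by (simp add: matrix_matrix_mult_def if_distrib[of "\<lambda>y. _ * y"] cong: if_cong)
      then show ?thesis by (simp add: matrix_matrix_mult_def[of "Q ** ?D"] transpose_def)
    qed
    \<comment> \<open>The diagonal is \<open>b\<close> everywhere plus \<open>1 - b\<close> at
      \<open>k\<close>: the first part gives \<open>b\<close> times the identity since
      \<open>Q\<close> is orthogonal, the second the rank-one term since column \<open>k\<close> of
      \<open>Q\<close> is \<open>s\<close>.\<close>
    also have "\<dots> = (\<Sum>l\<in>UNIV. b * (Q $ i $ l * Q $ j $ l) + (if l = k then (1 - b) * (Q $ i $ l * Q $ j $ l) else 0))"
      by (intro sum.cong) (auto simp: algebra_simps)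
    also have "\<dots> = b * (if i = j then 1 else 0) + (1 - b) * (s $ i * s $ j)"
      by (simp add: sum.distrib qt Qs flip: sum_distrib_left)
    finally show ?thesis by simp
    qed
    then show ?thesis unfolding vec_eq_iff by blast
  qed
  then have "det ?M = (det Q)\<^sup>2 * det ?D"
    by (simp add: det_mul det_transpose power2_eq_square)
  also have "(det Q)\<^sup>2 = 1"
    using det_orthogonal_matrix[OF Q(1)] by auto
  also have "det ?D = (\<Prod>i\<in>UNIV. if i = k then 1 else b)"
    by (subst det_diagonal) auto
  also have "\<dots> = b ^ (CARD('n) - 1)"
    by (subst prod.remove[of _ k]) (auto simp: card_Diff_singleton)
  finally show ?thesis by simp
qed

text \<open>The square root of the Gram determinant in Cartesian coordinates: the radial direction
  contributes 1, each of the \<open>N - 1\<close> tangential directions \<open>\<phi> r / r\<close>.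
  The value at the origin matches the Euclidean convention of \<open>metric\<close> there.\<close>

definition radial_density :: "(real \<Rightarrow> real) \<Rightarrow> real ^ 'n \<Rightarrow> real" where
  "radial_density \<phi> x = (if x = 0 then 1 else (\<phi> (norm x) / norm x) ^ (CARD('n) - 1))"

lemma sqrt_det_metric:
  fixes x :: "real ^ 'n"
  assumes "warping_function \<phi>"
  shows "sqrt (det (\<chi> i j. metric \<phi> x (axis i 1) (axis j 1))) = radial_density \<phi> x"
proof (cases "x = 0")
  case True
  have "(\<chi> i j. metric \<phi> x (axis i 1) (axis j 1)) = (mat 1 :: real ^ 'n ^ 'n)"
    using True by (simp add: metric_def inner_axis_axis mat_def vec_eq_iff)
  then show ?thesis using True by (simp add: radial_density_def)
next
  case False
  let ?b = "(\<phi> (norm x) / norm x)\<^sup>2"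
  have "(\<chi> i j. metric \<phi> x (axis i 1) (axis j 1)) =
      (\<chi> i j. ?b * (if i = j then 1 else 0) + (1 - ?b) * (sgn x $ i * sgn x $ j))"
    by (simp add: metric_scaled[OF assms False] inner_axis_axis inner_axis' vec_eq_iff) (simp add: axis_def algebra_simps)
  then have "det (\<chi> i j. metric \<phi> x (axis i 1) (axis j 1)) = ?b ^ (CARD('n) - 1)"
    using det_scaled_rank_one[of "sgn x" ?b] False by (simp add: norm_sgn)
  also have "\<dots> = ((\<phi> (norm x) / norm x) ^ (CARD('n) - 1))\<^sup>2"
    by (simp flip: power_mult add: mult.commute)
  finally show ?thesis
    using False warping_nonneg[OF assms, of "norm x"] by (simp add: radial_density_def)
qed

lemma riem_vol_eq:
  "warping_function \<phi> \<Longrightarrow> (riem_vol \<phi> :: (real ^ 'n) measure) = density lebesgue (\<lambda>x. ennreal (radial_density \<phi> x))"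
  by (simp add: riem_vol_def sqrt_det_metric)

lemma radial_density_pos: "warping_function \<phi> \<Longrightarrow> radial_density \<phi> x > 0"
  using warping_pos[of \<phi> "norm x"] by (simp add: radial_density_def)

lemma radial_density_measurable:
  assumes "warping_function \<phi>"
  shows "radial_density \<phi> \<in> borel_measurable borel"
proof -
  have [measurable]: "(\<lambda>x::real ^ 'n. \<phi> (norm x)) \<in> borel_measurable borel"
    by (rule warping_measurable[OF assms]) simp
  show ?thesis unfolding radial_density_def[abs_def] by measurable
qed

text \<open>The density is strictly positive, and completing a measure does not change
  almost-everywhere statements.\<close>

lemma AE_riem_vol_iff:
  fixes P :: "real ^ 'n \<Rightarrow> bool"
  assumes "warping_function \<phi>"
  shows "(AE x in riem_vol \<phi>. P x) \<longleftrightarrow> (AE x in lborel. P x)"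
proof -
  have "(\<lambda>x::real ^ 'n. ennreal (radial_density \<phi> x)) \<in> borel_measurable lebesgue"
    using radial_density_measurable[OF assms] by (intro measurable_completion) measurable
  then show ?thesis
    unfolding riem_vol_eq[OF assms]
    by (simp add: radial_density_pos[OF assms] AE_density AE_completion_iff)
qed

lemma nn_integral_riem_vol:
  fixes f :: "real ^ 'n \<Rightarrow> ennreal"
  assumes "warping_function \<phi>" "f \<in> borel_measurable borel"
  shows "(\<integral>\<^sup>+x. f x \<partial>riem_vol \<phi>) = (\<integral>\<^sup>+x. ennreal (radial_density \<phi> x) * f x \<partial>lborel)"
proof -
  have "(\<lambda>x::real ^ 'n. ennreal (radial_density \<phi> x)) \<in> borel_measurable lebesgue"
    using radial_density_measurable[OF assms(1)] by (intro measurable_completion) measurable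
  moreover have "f \<in> borel_measurable lebesgue"
    using assms(2) by (intro measurable_completion) simp
  ultimately show ?thesis
    by (simp add: riem_vol_eq[OF assms(1)] nn_integral_density nn_integral_completion)
qed

lemma metric_norm_measurable:
  fixes G :: "real ^ 'n \<Rightarrow> real ^ 'n"
  assumes "warping_function \<phi>" and G: "G \<in> borel_measurable (riem_vol \<phi>)"
  shows "(\<lambda>x. metric_norm \<phi> x (G x)) \<in> borel_measurable (riem_vol \<phi>)"
proof -
  have sets: "sets (riem_vol \<phi> :: (real ^ 'n) measure) = sets lebesgue"
    by (simp add: riem_vol_def)
  have [measurable]: "(\<lambda>x::real ^ 'n. \<phi> (norm x)) \<in> borel_measurable lebesgue"
      "(\<lambda>x::real ^ 'n. sgn x) \<in> borel_measurable lebesgue"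
    by (intro measurable_completion, simp add: warping_measurable[OF assms(1)],
        intro measurable_completion, simp add: sgn_div_norm[abs_def])
  have [measurable]: "G \<in> borel_measurable lebesgue"
    using G by (simp add: measurable_cong_sets[OF sets refl])
  have [measurable]: "(\<lambda>x::real ^ 'n. norm x) \<in> borel_measurable lebesgue"
    by (intro measurable_completion) simp
  have [measurable]: "{0::real^'n} \<in> sets lebesgue" by simp
  \<comment> \<open>Away from the origin \<open>metric_scaled\<close> gives an explicit expression
    in measurable functions; the case split is written as membership in a measurable
    singleton.\<close>
  have "(\<lambda>x. metric_norm \<phi> x (G x)) = (\<lambda>x. if x \<in> {0} then norm (G x) else
    sqrt ((G x \<bullet> sgn x) * (G x \<bullet> sgn x) +
    (\<phi> (norm x) / norm x)\<^sup>2 * (G x \<bullet> G x - (G x \<bullet> sgn x) * (G x \<bullet> sgn x))))"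
  proof
    fix x :: "real ^ 'n"
    show "metric_norm \<phi> x (G x) = (if x \<in> {0} then norm (G x) else
      sqrt ((G x \<bullet> sgn x) * (G x \<bullet> sgn x) +
      (\<phi> (norm x) / norm x)\<^sup>2 * (G x \<bullet> G x - (G x \<bullet> sgn x) * (G x \<bullet> sgn x))))"
    proof (cases "x = 0")
      case True
      then show ?thesis by (simp add: metric_norm_def metric_def norm_eq_sqrt_inner)
    next
      case False
      then show ?thesis by (simp add: metric_norm_def metric_scaled[OF assms(1)])
    qed
  qed
  also have "\<dots> \<in> borel_measurable lebesgue" by measurable
  finally show ?thesis by (simp add: measurable_cong_sets[OF sets refl])
qed

text \<open>The cone over the whole unit sphere is the punctured unit ball. This identifies the
  factor \<open>N\<close> of the polar formula times the ball volume with the sphere volume.\<close>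

lemma sphere_volume_eq:
  "sphere_volume TYPE('a::euclidean_space) = real DIM('a) * measure lborel (cball (0::'a) 1)"
proof -
  have "{t *\<^sub>R x |t x. 0 < t \<and> t \<le> 1 \<and> x \<in> sphere (0::'a) 1} = cball 0 1 - {0}"
  proof safe
    fix x :: 'a assume "x \<in> cball 0 1" "x \<noteq> 0"
    then show "\<exists>t y. x = t *\<^sub>R y \<and> 0 < t \<and> t \<le> 1 \<and> y \<in> sphere 0 1"
      by (intro exI[of _ "norm x"] exI[of _ "sgn x"]) (auto simp: norm_sgn sgn_div_norm)
  qed auto
  moreover have "measure lebesgue (cball (0::'a) 1 - {0}) = measure lborel (cball (0::'a) 1 - {0})"
    by (simp add: measure_completion)
  moreover have "\<dots> = measure lborel (cball (0::'a) 1)"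
    by (rule measure_Diff_null_set) auto
  ultimately show ?thesis by (simp add: sphere_volume_def sphere_measure_def)
qed

section \<open>Hoelder and Minkowski inequalities\<close>

lemma convex_on_powr_nonneg:
  fixes p x y a b :: real
  assumes p: "p \<ge> 1" and "x \<ge> 0" "y \<ge> 0" "a > 0" "b > 0" "a + b = 1"
  shows "(a * x + b * y) powr p \<le> a * x powr p + b * y powr p"
proof (cases "x = 0 \<or> y = 0")
  case False
  then have "x > 0" "y > 0" using assms by auto
  moreover have a: "a = 1 - b" using assms by simp
  ultimately show ?thesis
    using convex_onD[OF powr_convex[OF p], of b x y] assms(4,5) unfolding a by simp
next
  case True
  \<comment> \<open>If one of the two points is 0, convexity reduces to
    \<open>c powr p \<le> c\<close> for \<open>0 < c \<le> 1\<close>.\<close>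
  have *: "(c * z) powr p \<le> c * z powr p" if "0 < c" "c \<le> 1" "z \<ge> 0" for c z :: real
  proof -
    have "c powr p \<le> c powr 1" using that p by (intro powr_mono') auto
    then show ?thesis using that by (simp add: powr_mult mult_right_mono)
  qed
  show ?thesis using True *[of b y] *[of a x] assms p by auto
qed

text \<open>Stated for a function dominated by a sum, so that it serves functions with
  \<open>\<bar>u x\<bar>\<close> and vector fields with \<open>metric_norm\<close> alike.\<close>

lemma Minkowski_powr:
  fixes f g h :: "'a \<Rightarrow> real" and p :: real
  assumes p: "p \<ge> 1"
    and [measurable]: "f \<in> borel_measurable M"
    and g: "integrable M (\<lambda>x. g x powr p)" and h: "integrable M (\<lambda>x. h x powr p)"
    and nonneg: "\<And>x. 0 \<le> f x" "\<And>x. 0 \<le> g x" "\<And>x. 0 \<le> h x"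
    and le: "\<And>x. f x \<le> g x + h x"
  shows "integrable M (\<lambda>x. f x powr p)"
    and "(LINT x|M. f x powr p) powr (1 / p) \<le> (LINT x|M. g x powr p) powr (1 / p) + (LINT x|M. h x powr p) powr (1 / p)"
proof -
  let ?A = "(LINT x|M. g x powr p) powr (1 / p)" and ?B = "(LINT x|M. h x powr p) powr (1 / p)"
  \<comment> \<open>Convexity applied to \<open>g / A\<close> and \<open>h / B\<close> with weights
    \<open>A / (A + B)\<close> and \<open>B / (A + B)\<close>; with \<open>A\<close>,
    \<open>B\<close> close to the norms it integrates to Minkowski's inequality, with
    \<open>A = B = 1\<close> it gives integrability.\<close>
  have pw: "f x powr p \<le> (A + B) powr p * (A / (A + B) * (g x powr p / A powr p) + B / (A + B) * (h x powr p / B powr p))"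
    if "A > 0" "B > 0" for A B x
  proof -
    have "(A + B) * (A / (A + B) * (g x / A) + B / (A + B) * (h x / B)) = g x + h x"
      using that by (simp add: distrib_left)
    then have "f x powr p \<le> ((A + B) * (A / (A + B) * (g x / A) + B / (A + B) * (h x / B))) powr p"
      using le[of x] nonneg p by (simp add: powr_mono2)
    also have "\<dots> = (A + B) powr p * (A / (A + B) * (g x / A) + B / (A + B) * (h x / B)) powr p"
      by (rule powr_mult)
    also have "\<dots> \<le> (A + B) powr p * (A / (A + B) * (g x / A) powr p + B / (A + B) * (h x / B) powr p)"
      using that nonneg p
      by (intro mult_left_mono convex_on_powr_nonneg) (auto simp flip: add_divide_distrib)
    finally show ?thesis using that nonneg by (simp add: powr_divide)
  qed
  show int: "integrable M (\<lambda>x. f x powr p)"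
  proof (rule Bochner_Integration.integrable_bound)
    show "integrable M (\<lambda>x. (1 + 1) powr p * (1 / (1 + 1) * (g x powr p / 1 powr p) + 1 / (1 + 1) * (h x powr p / 1 powr p)))"
      using g h by auto
    show "AE x in M. norm (f x powr p) \<le> norm ((1 + 1) powr p * (1 / (1 + 1) * (g x powr p / 1 powr p) + 1 / (1 + 1) * (h x powr p / 1 powr p)))"
      using pw[of 1 1] by (auto simp: abs_of_nonneg)
  qed measurable
  show "(LINT x|M. f x powr p) powr (1 / p) \<le> ?A + ?B"
  proof (rule field_le_epsilon)
    fix e :: real assume e: "e > 0"
    \<comment> \<open>Adding \<open>e / 2\<close> keeps \<open>A\<close> and \<open>B\<close>
      positive even if a norm vanishes.\<close>
    define A where "A = ?A + e / 2"
    define B where "B = ?B + e / 2"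
    have AB: "A > 0" "B > 0" using e by (auto simp: A_def B_def add_nonneg_pos)
    have Ap: "(LINT x|M. g x powr p) \<le> A powr p" "(LINT x|M. h x powr p) \<le> B powr p"
    proof -
      have "?A powr p \<le> A powr p" "?B powr p \<le> B powr p"
        using e p by (auto simp: A_def B_def intro!: powr_mono2)
      then show "(LINT x|M. g x powr p) \<le> A powr p" "(LINT x|M. h x powr p) \<le> B powr p"
        using p by (auto simp: powr_powr powr_one')
    qed
    have "(LINT x|M. f x powr p) \<le>
      (LINT x|M. (A + B) powr p * (A / (A + B) * (g x powr p / A powr p) + B / (A + B) * (h x powr p / B powr p)))"
      using pw[OF AB] g h int by (intro integral_mono) auto
    also have "\<dots> = (A + B) powr p * (A / (A + B) * ((LINT x|M. g x powr p) / A powr p) + B / (A + B) * ((LINT x|M. h x powr p) / B powr p))"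
      using g h by simp
    also have "\<dots> \<le> (A + B) powr p * (A / (A + B) * 1 + B / (A + B) * 1)"
      using AB Ap by (intro mult_left_mono add_mono) auto
    also have "A / (A + B) * 1 + B / (A + B) * 1 = 1"
      using AB by (simp flip: add_divide_distrib)
    finally have "(LINT x|M. f x powr p) powr (1 / p) \<le> ((A + B) powr p) powr (1 / p)"
      using p by (intro powr_mono2) auto
    also have "\<dots> = ?A + ?B + e"
      using AB p by (simp add: powr_powr powr_one' A_def B_def)
    finally show "(LINT x|M. f x powr p) powr (1 / p) \<le> ?A + ?B + e" .
  qed
qed

text \<open>Hoelder for the exponents \<open>p / (p - 1)\<close> and \<open>p\<close>: the first
  factor \<open>a powr (p - 1)\<close>, raised to its exponent, is \<open>a powr p\<close>. The
  nonnegative integral includes the finiteness of the left side.\<close>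

lemma Hoelder_powr:
  fixes a b :: "'a \<Rightarrow> real" and p :: real
  assumes p: "p > 1"
    and [measurable]: "a \<in> borel_measurable M" "b \<in> borel_measurable M"
    and ia: "integrable M (\<lambda>x. a x powr p)" and ib: "integrable M (\<lambda>x. b x powr p)"
    and nonneg: "\<And>x. 0 \<le> a x" "\<And>x. 0 \<le> b x"
  shows "(\<integral>\<^sup>+x. ennreal (a x powr (p - 1) * b x) \<partial>M) \<le>
    ennreal (((LINT x|M. a x powr p) powr (1 / p)) powr (p - 1) * (LINT x|M. b x powr p) powr (1 / p))"
proof -
  let ?A = "LINT x|M. a x powr p" and ?B = "LINT x|M. b x powr p"
  have "?A \<ge> 0" "?B \<ge> 0" by auto
  show ?thesis
  proof (cases "?A = 0 \<or> ?B = 0")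
    \<comment> \<open>A vanishing integral makes one factor, hence the product, zero almost
      everywhere.\<close>
    case True
    then have "(AE x in M. a x powr p = 0) \<or> (AE x in M. b x powr p = 0)"
      using integral_nonneg_eq_0_iff_AE[OF ia] integral_nonneg_eq_0_iff_AE[OF ib] by auto
    then have "AE x in M. ennreal (a x powr (p - 1) * b x) = 0"
      by (elim disjE AE_mp) auto
    then have "(\<integral>\<^sup>+x. ennreal (a x powr (p - 1) * b x) \<partial>M) = 0"
      by (subst nn_integral_0_iff_AE) auto
    then show ?thesis by simp
  next
    case False
    then have AB: "?A > 0" "?B > 0" using \<open>?A \<ge> 0\<close> \<open>?B \<ge> 0\<close> by linarith+
    \<comment> \<open>\<open>K\<close> is the claimed bound with exponents rearranged. Young's
      inequality is applied to \<open>a powr p / ?A\<close> and \<open>b powr p / ?B\<close>, both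
      of integral 1, with weights \<open>1 - 1 / p\<close> and \<open>1 / p\<close> of sum
      1.\<close>
    define K where "K = ?A powr (1 - 1 / p) * ?B powr (1 / p)"
    have K: "K \<ge> 0" by (simp add: K_def)
    have pw: "a x powr (p - 1) * b x \<le> K * ((1 - 1 / p) * (a x powr p / ?A) + 1 / p * (b x powr p / ?B))" for x
    proof (cases "a x = 0 \<or> b x = 0")
      case True
      have "0 \<le> K * ((1 - 1 / p) * (a x powr p / ?A) + 1 / p * (b x powr p / ?B))"
        using K AB p by (intro mult_nonneg_nonneg add_nonneg_nonneg) auto
      then show ?thesis using True by auto
    next
      case False
      then have ab: "a x > 0" "b x > 0" using nonneg[of x] by auto
      have "a x powr (p - 1) * b x = K * ((a x powr p / ?A) powr (1 - 1 / p) * (b x powr p / ?B) powr (1 / p))"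
        using ab AB p by (simp add: K_def powr_divide powr_powr powr_one' right_diff_distrib)
      also have "\<dots> \<le> K * ((1 - 1 / p) * (a x powr p / ?A) + 1 / p * (b x powr p / ?B))"
        using ab AB p K by (intro mult_left_mono Youngs_inequality_0) auto
      finally show ?thesis .
    qed
    have "(\<integral>\<^sup>+x. ennreal (a x powr (p - 1) * b x) \<partial>M) \<le>
      (\<integral>\<^sup>+x. ennreal (K * ((1 - 1 / p) * (a x powr p / ?A) + 1 / p * (b x powr p / ?B))) \<partial>M)"
      by (intro nn_integral_mono ennreal_leI pw)
    also have "\<dots> = ennreal (LINT x|M. K * ((1 - 1 / p) * (a x powr p / ?A) + 1 / p * (b x powr p / ?B)))"
      using ia ib K AB p
      by (intro nn_integral_eq_integral) (auto intro!: mult_nonneg_nonneg add_nonneg_nonneg)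
    also have "(LINT x|M. K * ((1 - 1 / p) * (a x powr p / ?A) + 1 / p * (b x powr p / ?B))) = K"
      using ia ib AB by simp
    also have "K = (?A powr (1 / p)) powr (p - 1) * ?B powr (1 / p)"
      using p by (simp add: K_def powr_powr right_diff_distrib diff_divide_distrib)
    finally show ?thesis .
  qed
qed

section \<open>Estimates along rays\<close>

text \<open>Only the bound \<open>K\<close> is continuous, so \<open>g'\<close> itself is not
  integrated: for an antiderivative \<open>H\<close> of \<open>K\<close>, both \<open>H - g\<close>
  and \<open>H + g\<close> are nondecreasing.\<close>

lemma diff_le_nn_integral_derivative:
  fixes g g' K :: "real \<Rightarrow> real"
  assumes "\<And>s. (g has_real_derivative g' s) (at s)"
    and K: "continuous_on UNIV K" "\<And>s. \<bar>g' s\<bar> \<le> K s" and tT: "t \<le> T"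
  shows "ennreal \<bar>g t - g T\<bar> \<le> (\<integral>\<^sup>+s. ennreal (K s) * indicator {t..T} s \<partial>lborel)"
proof -
  \<comment> \<open>The interval is enlarged on both sides so that \<open>H\<close> has a two-sided
    derivative at the endpoints \<open>t\<close> and \<open>T\<close>.\<close>
  have "continuous_on {t - 1..T + 1} K" using K(1) continuous_on_subset by blast
  then obtain H where H': "\<And>x. x \<in> {t - 1..T + 1} \<Longrightarrow> (H has_vector_derivative K x) (at x within {t - 1..T + 1})"
    using antiderivative_continuous by blast
  have H: "(H has_real_derivative K x) (at x)" if "t \<le> x" "x \<le> T" for x
    using H'[of x] that
    by (simp add: at_within_Icc_at flip: has_real_derivative_iff_has_vector_derivative)
  have mono: "H t - c * g t \<le> H T - c * g T" if c: "\<bar>c\<bar> = 1" for c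
  proof (rule DERIV_nonneg_imp_nondecreasing[OF tT, of "\<lambda>s. H s - c * g s"], intro exI conjI)
    fix s assume "t \<le> s" "s \<le> T"
    then show "((\<lambda>s. H s - c * g s) has_real_derivative K s - c * g' s) (at s)"
      using H assms(1) by (auto intro!: derivative_eq_intros)
    show "0 \<le> K s - c * g' s"
      using K(2)[of s] c abs_ge_self[of "c * g' s"] by (simp add: abs_mult)
  qed
  have "ennreal \<bar>g t - g T\<bar> \<le> ennreal (H T - H t)"
    using mono[of 1] mono[of "- 1"] by (intro ennreal_leI) auto
  also have "\<dots> = (\<integral>\<^sup>+s. ennreal (K s) * indicator {t..T} s \<partial>lborel)"
  proof (rule nn_integral_FTC_Icc[symmetric])
    show "K \<in> borel_measurable borel" using K(1) by (rule borel_measurable_continuous_onI)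
  qed (use H K(2) tT in \<open>auto intro: order_trans[OF abs_ge_zero]\<close>)
  finally show ?thesis .
qed

text \<open>For \<open>p > 1\<close> the function is differentiable at 0 too, so zeros of a composed
  function require no splitting of the ray.\<close>

lemma has_real_derivative_abs_powr:
  fixes y p :: real
  assumes p: "p > 1"
  shows "((\<lambda>y. \<bar>y\<bar> powr p) has_real_derivative p * (sgn y * \<bar>y\<bar> powr (p - 1))) (at y)"
proof (cases "y = 0")
  case False
  show ?thesis
  proof (cases "y > 0")
    case True
    have "((\<lambda>y. y powr p) has_real_derivative p * (sgn y * \<bar>y\<bar> powr (p - 1))) (at y)"
      using True by (auto intro!: derivative_eq_intros)
    moreover have "eventually (\<lambda>z. z > 0) (nhds y)" using eventually_nhds_in_open[of "{0<..}" y] True by simp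
    ultimately show ?thesis
      by (subst DERIV_cong_ev[OF refl _ refl]) (auto elim!: eventually_mono)
  next
    case False
    then have y: "y < 0" using \<open>y \<noteq> 0\<close> by simp
    then have "((\<lambda>y. (- y) powr p) has_real_derivative p * (sgn y * \<bar>y\<bar> powr (p - 1))) (at y)"
      by (auto intro!: derivative_eq_intros)
    moreover have "eventually (\<lambda>z. z < 0) (nhds y)" using eventually_nhds_in_open[of "{..<0}" y] y by simp
    ultimately show ?thesis
      by (subst DERIV_cong_ev[OF refl _ refl]) (auto elim!: eventually_mono)
  qed
next
  case True
  \<comment> \<open>The difference quotient at 0 is
    \<open>sgn h * \<bar>h\<bar> powr (p - 1)\<close>, which tends to 0 because
    \<open>p - 1 > 0\<close>.\<close>
  have "((\<lambda>h::real. \<bar>h\<bar> powr (p - 1)) \<longlongrightarrow> 0) (at 0)"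
    using p by (auto intro!: tendsto_eq_intros tendsto_zero_powrI[where b="p - 1"])
  then have "((\<lambda>h. sgn h * \<bar>h\<bar> powr (p - 1)) \<longlongrightarrow> 0) (at 0)"
    by (rule Lim_null_comparison[rotated]) (auto simp: abs_mult abs_sgn_eq)
  moreover have "\<bar>h\<bar> powr p / h = sgn h * \<bar>h\<bar> powr (p - 1)" if "h \<noteq> 0" for h :: real
    using that by (cases "h > 0") (auto simp: powr_diff)
  ultimately have "((\<lambda>h. \<bar>h\<bar> powr p / h) \<longlongrightarrow> 0) (at 0)"
    by (subst tendsto_cong[where g="\<lambda>h. sgn h * \<bar>h\<bar> powr (p - 1)"]) (auto simp: eventually_at_filter)
  then show ?thesis using True p by (simp add: has_field_derivative_iff)
qed

text \<open>The factor \<open>\<bar>y\<bar>\<^bsup>p-1\<^esup>\<close>; for \<open>p = 1\<close> the junk value \<open>0 powr 0 = 0\<close> has to be avoided.\<close>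

definition powr_weight :: "real \<Rightarrow> real \<Rightarrow> real" where
  "powr_weight p y = (if p = 1 then 1 else \<bar>y\<bar> powr (p - 1))"

lemma powr_weight_nonneg: "powr_weight p y \<ge> 0"
  by (simp add: powr_weight_def)

lemma continuous_on_powr_weight:
  assumes "p \<ge> 1" "continuous_on S f"
  shows "continuous_on S (\<lambda>x. powr_weight p (f x))"
proof (cases "p = 1")
  case False
  then have "p > 1" using assms by simp
  then show ?thesis using assms(2) False unfolding powr_weight_def
    by (simp, intro continuous_on_powr' continuous_intros) auto
qed (simp add: powr_weight_def)

lemma abs_powr_diff_le:
  fixes f f' :: "real \<Rightarrow> real"
  assumes p: "p \<ge> 1" and f: "\<And>s. (f has_real_derivative f' s) (at s)"
    and f': "continuous_on UNIV f'" and tT: "t \<le> T"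
  shows "ennreal (\<bar>f t\<bar> powr p) \<le> ennreal (\<bar>f T\<bar> powr p) +
    (\<integral>\<^sup>+s. ennreal (p * (powr_weight p (f s) * \<bar>f' s\<bar>)) * indicator {t..T} s \<partial>lborel)" (is "_ \<le> _ + ?I")
proof -
  have cf: "continuous_on UNIV f"
    using f by (meson DERIV_isCont continuous_at_imp_continuous_on)
  have cK: "continuous_on UNIV (\<lambda>s. p * (powr_weight p (f s) * \<bar>f' s\<bar>))"
    by (intro continuous_intros continuous_on_powr_weight p cf f')
  \<comment> \<open>To be used with \<open>g = f\<close> for \<open>p = 1\<close>, as the absolute
    value is not differentiable at 0, and with \<open>g = \<bar>f\<bar> powr p\<close> for
    \<open>p > 1\<close>.\<close>
  have *: "ennreal (\<bar>f t\<bar> powr p) \<le> ennreal (\<bar>f T\<bar> powr p) + ?I"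
    if "ennreal \<bar>g t - g T\<bar> \<le> ?I" "\<bar>f t\<bar> powr p \<le> \<bar>f T\<bar> powr p + \<bar>g t - g T\<bar>" for g
  proof -
    have "ennreal (\<bar>f t\<bar> powr p) \<le> ennreal (\<bar>f T\<bar> powr p + \<bar>g t - g T\<bar>)"
      using that(2) by (rule ennreal_leI)
    also have "\<dots> = ennreal (\<bar>f T\<bar> powr p) + ennreal \<bar>g t - g T\<bar>"
      by (simp flip: ennreal_plus)
    also have "\<dots> \<le> ennreal (\<bar>f T\<bar> powr p) + ?I" using that(1) by (rule add_left_mono)
    finally show ?thesis .
  qed
  show ?thesis
  proof (cases "p = 1")
    case True
    have "ennreal \<bar>f t - f T\<bar> \<le> ?I"
      by (rule diff_le_nn_integral_derivative[OF f cK _ tT]) (simp add: True powr_weight_def)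
    then show ?thesis by (rule *) (use True in auto)
  next
    case False
    then have p1: "p > 1" using p by simp
    have "((\<lambda>s. \<bar>f s\<bar> powr p) has_real_derivative p * (sgn (f s) * \<bar>f s\<bar> powr (p - 1)) * f' s) (at s)" for s
      by (rule DERIV_chain2[OF has_real_derivative_abs_powr[OF p1] f])
    then have "ennreal \<bar>\<bar>f t\<bar> powr p - \<bar>f T\<bar> powr p\<bar> \<le> ?I"
      by (rule diff_le_nn_integral_derivative[OF _ cK _ tT])
         (use p1 in \<open>auto simp: powr_weight_def abs_mult abs_sgn_eq\<close>)
    then show ?thesis by (rule *) auto
  qed
qed

lemma abs_powr_le_nn_integral:
  fixes f f' :: "real \<Rightarrow> real"
  assumes p: "p \<ge> 1" and f: "\<And>s. (f has_real_derivative f' s) (at s)"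
    and f': "continuous_on UNIV f'"
    and fin: "(\<integral>\<^sup>+s. ennreal (\<bar>f s\<bar> powr p) * indicator {t..} s \<partial>lborel) < \<infinity>"
  shows "ennreal (\<bar>f t\<bar> powr p) \<le>
    (\<integral>\<^sup>+s. ennreal (p * (powr_weight p (f s) * \<bar>f' s\<bar>)) * indicator {t..} s \<partial>lborel)" (is "_ \<le> ?I")
proof (rule ennreal_le_epsilon)
  fix e :: real assume e: "e > 0"
  \<comment> \<open>Otherwise the integrand is at least \<open>e\<close> on a half-line of infinite
    measure. One such \<open>T\<close> for each \<open>e\<close> removes the boundary term; no limit
    of \<open>f\<close> at infinity is taken.\<close>
  have "\<exists>T\<ge>t. \<bar>f T\<bar> powr p < e"
  proof (rule ccontr)
    assume "\<not> ?thesis"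
    then have "(\<integral>\<^sup>+s. ennreal e * indicator {t..} s \<partial>lborel) \<le> (\<integral>\<^sup>+s. ennreal (\<bar>f s\<bar> powr p) * indicator {t..} s \<partial>lborel)"
      by (intro nn_integral_mono) (auto simp: indicator_def not_less intro!: ennreal_leI)
    moreover have "(\<integral>\<^sup>+s. ennreal e * indicator {t..} s \<partial>lborel) = \<infinity>"
    proof -
      have "ennreal (real n) \<le> emeasure lborel {t..}" for n
        using emeasure_mono[of "{t..t + real n}" "{t..}" lborel] by simp
      then have "emeasure lborel {t..} = \<infinity>"
        by (metis ennreal_Ex_less_of_nat ennreal_of_nat_eq_real_of_nat infinity_ennreal_def not_le top.not_eq_extremum)
      then show ?thesis using e by (simp add: nn_integral_cmult_indicator ennreal_mult_top)
    qed
    ultimately show False using fin by auto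
  qed
  then obtain T where T: "t \<le> T" "\<bar>f T\<bar> powr p < e" by auto
  have "ennreal (\<bar>f t\<bar> powr p) \<le> ennreal (\<bar>f T\<bar> powr p) +
    (\<integral>\<^sup>+s. ennreal (p * (powr_weight p (f s) * \<bar>f' s\<bar>)) * indicator {t..T} s \<partial>lborel)"
    by (rule abs_powr_diff_le[OF p f f' T(1)])
  also have "\<dots> \<le> ennreal e + ?I"
    using T(2) by (intro add_mono nn_integral_mono ennreal_leI) (auto simp: indicator_def)
  finally show "ennreal (\<bar>f t\<bar> powr p) \<le> ?I + ennreal e" by (simp add: add.commute)
qed

text \<open>\<open>E\<close> is not known to be finite beforehand; an infinite \<open>E\<close>
  would make the left side of the assumption infinite.\<close>

lemma ennreal_le_divideI:
  assumes "ennreal c * E \<le> ennreal X" "c > 0" "X \<ge> 0"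
  shows "E \<le> ennreal (X / c)"
proof (cases E rule: ennreal_cases)
  case (real e)
  then show ?thesis
    using assms by (simp add: pos_le_divide_eq mult.commute ennreal_leI flip: ennreal_mult)
next
  case top
  then show ?thesis using assms by (simp add: ennreal_mult_top top_unique)
qed

lemma borel_measurable_warping_abs:
  "warping_function \<phi> \<Longrightarrow> (\<lambda>s. \<phi> \<bar>s\<bar>) \<in> borel_measurable borel"
  using warping_measurable[of \<phi> "\<lambda>s::real. s" borel] by simp

text \<open>The Euclidean factor \<open>t ^ (N - 1)\<close> cancels the denominator of the density
  \<open>(\<phi> t / t) ^ (N - 1)\<close>.\<close>

lemma nn_integral_riem_vol_polar:
  fixes f :: "real ^ 'n \<Rightarrow> ennreal"
  assumes \<phi>: "warping_function \<phi>" and f[measurable]: "f \<in> borel_measurable borel"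
  shows "(\<integral>\<^sup>+x. f x \<partial>riem_vol \<phi>) = ennreal (real CARD('n)) *
    (\<integral>\<^sup>+x\<in>cball 0 1. (\<integral>\<^sup>+t. indicator {0<..} t * ennreal (\<phi> \<bar>t\<bar> ^ (CARD('n) - 1)) * f (t *\<^sub>R sgn x) \<partial>lborel) \<partial>lborel)"
proof -
  note [measurable] = radial_density_measurable[OF \<phi>]
  have "(\<integral>\<^sup>+x. f x \<partial>riem_vol \<phi>) = ennreal (real CARD('n)) *
    (\<integral>\<^sup>+x\<in>cball 0 1. (\<integral>\<^sup>+t. indicator {0<..} t * ennreal (t ^ (CARD('n) - 1)) *
      (ennreal (radial_density \<phi> (t *\<^sub>R sgn x)) * f (t *\<^sub>R sgn x)) \<partial>lborel) \<partial>lborel)"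
    unfolding nn_integral_riem_vol[OF \<phi> f] by (subst nn_integral_polar) auto
  also have "(\<integral>\<^sup>+x\<in>cball 0 1. (\<integral>\<^sup>+t. indicator {0<..} t * ennreal (t ^ (CARD('n) - 1)) *
      (ennreal (radial_density \<phi> (t *\<^sub>R sgn x)) * f (t *\<^sub>R sgn x)) \<partial>lborel) \<partial>lborel) =
    (\<integral>\<^sup>+x\<in>cball 0 1. (\<integral>\<^sup>+t. indicator {0<..} t * ennreal (\<phi> \<bar>t\<bar> ^ (CARD('n) - 1)) * f (t *\<^sub>R sgn x) \<partial>lborel) \<partial>lborel)"
  proof (rule nn_integral_cong_AE, rule AE_mp[OF AE_lborel_singleton[of 0]], rule AE_I2, rule impI)
    fix x :: "real ^ 'n" assume x: "x \<noteq> 0"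
    have "indicator {0<..} t * ennreal (t ^ (CARD('n) - 1)) * (ennreal (radial_density \<phi> (t *\<^sub>R sgn x)) * f (t *\<^sub>R sgn x))
      = indicator {0<..} t * ennreal (\<phi> \<bar>t\<bar> ^ (CARD('n) - 1)) * f (t *\<^sub>R sgn x)" for t
    proof (cases "t > 0")
      case t: True
      have "ennreal (t ^ (CARD('n) - 1)) * ennreal (radial_density \<phi> (t *\<^sub>R sgn x)) = ennreal (\<phi> \<bar>t\<bar> ^ (CARD('n) - 1))"
        using t x warping_nonneg[OF \<phi>, of t]
        by (simp add: radial_density_def norm_sgn sgn_zero_iff power_divide flip: ennreal_mult)
      then show ?thesis by (simp add: mult.assoc[symmetric]) (simp add: mult.assoc)
    qed simp
    then show "(\<integral>\<^sup>+t. indicator {0<..} t * ennreal (t ^ (CARD('n) - 1)) *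
      (ennreal (radial_density \<phi> (t *\<^sub>R sgn x)) * f (t *\<^sub>R sgn x)) \<partial>lborel) * indicator (cball 0 1) x =
      (\<integral>\<^sup>+t. indicator {0<..} t * ennreal (\<phi> \<bar>t\<bar> ^ (CARD('n) - 1)) * f (t *\<^sub>R sgn x) \<partial>lborel) * indicator (cball 0 1) x"
      by simp
  qed
  finally show ?thesis .
qed

lemma ray_has_real_derivative:
  fixes u :: "'a::euclidean_space \<Rightarrow> real"
  assumes "u differentiable (at (s *\<^sub>R a))"
  shows "((\<lambda>s. u (s *\<^sub>R a)) has_real_derivative frechet_derivative u (at (s *\<^sub>R a)) a) (at s)"
proof -
  let ?D = "frechet_derivative u (at (s *\<^sub>R a))"
  have D: "(u has_derivative ?D) (at (s *\<^sub>R a))"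
    using assms by (simp add: frechet_derivative_works)
  have "((\<lambda>s. s *\<^sub>R a) has_derivative (\<lambda>h. h *\<^sub>R a)) (at s)"
    by (auto intro!: derivative_eq_intros)
  from has_derivative_compose[OF this D]
  have "((\<lambda>s. u (s *\<^sub>R a)) has_derivative (\<lambda>h. ?D (h *\<^sub>R a))) (at s)" .
  moreover have "(\<lambda>h. ?D (h *\<^sub>R a)) = (*) (?D a)"
    using linear_frechet_derivative[OF assms] by (simp add: linear_cmul mult.commute fun_eq_iff)
  ultimately show ?thesis by (simp add: has_field_derivative_def)
qed

lemma
  assumes "C_k (Suc 0) u"
  shows C_1_differentiable: "u differentiable (at x)"
    and C_1_continuous_derivative: "continuous_on UNIV (\<lambda>x. frechet_derivative u (at x) v)"
    and C_1_continuous: "continuous_on UNIV u"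
proof -
  show d: "u differentiable (at x)" "continuous_on UNIV (\<lambda>x. frechet_derivative u (at x) v)" for x
    using assms by auto
  show "continuous_on UNIV u"
    by (intro continuous_at_imp_continuous_on ballI differentiable_imp_continuous_within d)
qed

text \<open>The direction \<open>sgn x\<close> varies with the point while \<open>C_k\<close> speaks
  of fixed directions; expansion in the basis reduces to these.\<close>

lemma borel_measurable_radial_derivative:
  fixes u :: "'a::euclidean_space \<Rightarrow> real"
  assumes "C_k (Suc 0) u"
  shows "(\<lambda>x. frechet_derivative u (at x) (sgn x)) \<in> borel_measurable borel"
proof -
  have [measurable]: "(\<lambda>x. frechet_derivative u (at x) b) \<in> borel_measurable borel" for b
    by (rule borel_measurable_continuous_onI[OF C_1_continuous_derivative[OF assms]])
  have "frechet_derivative u (at x) (sgn x) = (\<Sum>b\<in>Basis. (sgn x \<bullet> b) * frechet_derivative u (at x) b)" for x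
  proof -
    note lin = linear_frechet_derivative[OF C_1_differentiable[OF assms, of x]]
    have "frechet_derivative u (at x) (sgn x) = frechet_derivative u (at x) (\<Sum>b\<in>Basis. (sgn x \<bullet> b) *\<^sub>R b)"
      by (simp add: euclidean_representation)
    then show ?thesis by (simp add: linear_sum[OF lin] linear_cmul[OF lin])
  qed
  then show ?thesis by simp
qed

text \<open>For \<open>s \<ge> t\<close> the constant on the left is at most
  \<open>\<phi> s ^ k\<close>. This comparison, \<open>tail\<close>, is used twice: it makes the
  unweighted integral of \<open>\<bar>f\<bar> powr p\<close> over the tail finite, and it restores
  the weight in the resulting estimate.\<close>

lemma warped_ray_estimate:
  fixes \<phi> f f' :: "real \<Rightarrow> real"
  assumes \<phi>: "warping_function \<phi>" and C: "warping_const \<phi> > 0" and p: "p \<ge> 1" and t: "t > 0"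
    and f: "\<And>s. (f has_real_derivative f' s) (at s)" and f': "continuous_on UNIV f'"
    and fin: "(\<integral>\<^sup>+s. indicator {0<..} s * ennreal (\<phi> \<bar>s\<bar> ^ k) * ennreal (\<bar>f s\<bar> powr p) \<partial>lborel) \<noteq> \<infinity>"
  shows "ennreal (warping_const \<phi> ^ k * \<phi> t ^ k) * ennreal (\<bar>f t\<bar> powr p) \<le>
    (\<integral>\<^sup>+s. indicator {0<..} s * ennreal (\<phi> \<bar>s\<bar> ^ k) * ennreal (p * (powr_weight p (f s) * \<bar>f' s\<bar>)) \<partial>lborel)"
proof -
  define c where "c = warping_const \<phi> ^ k * \<phi> t ^ k"
  have c: "c > 0" using C warping_pos[OF \<phi> t] by (simp add: c_def)
  have cle: "c \<le> \<phi> s ^ k" if "t \<le> s" for s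
    unfolding c_def power_mult_distrib[symmetric]
    using warping_const_le[OF \<phi> t that] C warping_pos[OF \<phi> t] by (intro power_mono) auto
  have "continuous_on UNIV f"
    using f by (meson DERIV_isCont continuous_at_imp_continuous_on)
  then have [measurable]: "f \<in> borel_measurable borel" by (rule borel_measurable_continuous_onI)
  have [measurable]: "(\<lambda>s. powr_weight p (f s)) \<in> borel_measurable borel"
    by (intro borel_measurable_continuous_onI continuous_on_powr_weight p \<open>continuous_on UNIV f\<close>)
  have [measurable]: "f' \<in> borel_measurable borel" using f' by (rule borel_measurable_continuous_onI)
  have tail: "ennreal c * (\<integral>\<^sup>+s. ennreal (h s) * indicator {t..} s \<partial>lborel) \<le>
      (\<integral>\<^sup>+s. indicator {0<..} s * ennreal (\<phi> \<bar>s\<bar> ^ k) * ennreal (h s) \<partial>lborel)"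
    if [measurable]: "h \<in> borel_measurable borel" for h
  proof -
    have "ennreal c * (\<integral>\<^sup>+s. ennreal (h s) * indicator {t..} s \<partial>lborel) =
        (\<integral>\<^sup>+s. ennreal c * (ennreal (h s) * indicator {t..} s) \<partial>lborel)"
      by (rule nn_integral_cmult[symmetric]) measurable
    also have "\<dots> \<le> (\<integral>\<^sup>+s. indicator {0<..} s * ennreal (\<phi> \<bar>s\<bar> ^ k) * ennreal (h s) \<partial>lborel)"
      using t by (intro nn_integral_mono) (auto simp: indicator_def intro!: mult_right_mono ennreal_leI cle)
    finally show ?thesis .
  qed
  have "ennreal c * (\<integral>\<^sup>+s. ennreal (\<bar>f s\<bar> powr p) * indicator {t..} s \<partial>lborel) < \<infinity>"
    using tail[of "\<lambda>s. \<bar>f s\<bar> powr p"] fin by (auto simp: less_top intro: le_less_trans)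
  then have "(\<integral>\<^sup>+s. ennreal (\<bar>f s\<bar> powr p) * indicator {t..} s \<partial>lborel) < \<infinity>"
    using c by (auto simp: ennreal_mult_less_top)
  from abs_powr_le_nn_integral[OF p f f' this]
  have "ennreal c * ennreal (\<bar>f t\<bar> powr p) \<le> ennreal c *
    (\<integral>\<^sup>+s. ennreal (p * (powr_weight p (f s) * \<bar>f' s\<bar>)) * indicator {t..} s \<partial>lborel)"
    by (rule mult_left_mono) simp
  also have "\<dots> \<le> (\<integral>\<^sup>+s. indicator {0<..} s * ennreal (\<phi> \<bar>s\<bar> ^ k) * ennreal (p * (powr_weight p (f s) * \<bar>f' s\<bar>)) \<partial>lborel)"
    by (rule tail) measurable
  finally show ?thesis by (simp add: c_def)
qed

section \<open>Bounds for spherical means\<close>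

text \<open>The ray estimate is integrated over all directions; polar coordinates reassemble the
  right side into an integral over the manifold.\<close>

lemma sphere_mean_le_nn_integral:
  fixes u :: "real ^ 'n \<Rightarrow> real"
  assumes \<phi>: "warping_function \<phi>" and C: "warping_const \<phi> > 0" and p: "p \<ge> 1" and t: "t > 0"
    and u: "C_k (Suc 0) u" and up: "(\<integral>\<^sup>+x. ennreal (\<bar>u x\<bar> powr p) \<partial>riem_vol \<phi>) \<noteq> \<infinity>"
  shows "ennreal (warping_const \<phi> ^ (CARD('n) - 1) * \<phi> t ^ (CARD('n) - 1)) *
      (ennreal (real CARD('n)) * (\<integral>\<^sup>+x\<in>cball 0 1. ennreal (\<bar>u (t *\<^sub>R sgn x)\<bar> powr p) \<partial>lborel)) \<le>
    (\<integral>\<^sup>+x. ennreal (p * (powr_weight p (u x) * \<bar>frechet_derivative u (at x) (sgn x)\<bar>)) \<partial>riem_vol \<phi>)"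
proof -
  let ?k = "CARD('n) - 1"
  let ?F = "\<lambda>x. ennreal (p * (powr_weight p (u x) * \<bar>frechet_derivative u (at x) (sgn x)\<bar>))"
  let ?c = "ennreal (warping_const \<phi> ^ ?k * \<phi> t ^ ?k)"
  note [measurable] = borel_measurable_radial_derivative[OF u] borel_measurable_warping_abs[OF \<phi>]
  have [measurable]: "u \<in> borel_measurable borel"
    using C_1_continuous[OF u] by (rule borel_measurable_continuous_onI)
  have [measurable]: "(\<lambda>x. powr_weight p (u x)) \<in> borel_measurable borel"
    by (intro borel_measurable_continuous_onI continuous_on_powr_weight p C_1_continuous[OF u])
  \<comment> \<open>By polar coordinates the integral of \<open>\<bar>u\<bar> powr p\<close> is
    finite along almost every ray, as the ray estimate demands.\<close>
  have "(\<integral>\<^sup>+x\<in>cball 0 1. (\<integral>\<^sup>+s. indicator {0<..} s * ennreal (\<phi> \<bar>s\<bar> ^ ?k) * ennreal (\<bar>u (s *\<^sub>R sgn x)\<bar> powr p) \<partial>lborel) \<partial>lborel) \<noteq> \<infinity>"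
    using up by (subst (asm) nn_integral_riem_vol_polar[OF \<phi>]) (auto simp: ennreal_mult_eq_top_iff)
  then have "AE x in lborel. (\<integral>\<^sup>+s. indicator {0<..} s * ennreal (\<phi> \<bar>s\<bar> ^ ?k) * ennreal (\<bar>u (s *\<^sub>R sgn (x :: real ^ 'n))\<bar> powr p) \<partial>lborel) * indicator (cball 0 1) x \<noteq> \<infinity>"
    by (intro nn_integral_PInf_AE) measurable
  then have fin: "AE x in lborel. x \<in> cball 0 1 \<longrightarrow> (\<integral>\<^sup>+s. indicator {0<..} s * ennreal (\<phi> \<bar>s\<bar> ^ ?k) * ennreal (\<bar>u (s *\<^sub>R sgn (x :: real ^ 'n))\<bar> powr p) \<partial>lborel) \<noteq> \<infinity>"
    by (rule eventually_mono) auto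
  have ray: "?c * ennreal (\<bar>u (t *\<^sub>R sgn x)\<bar> powr p) \<le> (\<integral>\<^sup>+s. indicator {0<..} s * ennreal (\<phi> \<bar>s\<bar> ^ ?k) * ?F (s *\<^sub>R sgn x) \<partial>lborel)"
    if "x \<noteq> 0" and "(\<integral>\<^sup>+s. indicator {0<..} s * ennreal (\<phi> \<bar>s\<bar> ^ ?k) * ennreal (\<bar>u (s *\<^sub>R sgn x)\<bar> powr p) \<partial>lborel) \<noteq> \<infinity>" for x
  proof -
    let ?D = "\<lambda>s. frechet_derivative u (at (s *\<^sub>R sgn x)) (sgn x)"
    have "?c * ennreal (\<bar>u (t *\<^sub>R sgn x)\<bar> powr p) \<le>
      (\<integral>\<^sup>+s. indicator {0<..} s * ennreal (\<phi> \<bar>s\<bar> ^ ?k) * ennreal (p * (powr_weight p (u (s *\<^sub>R sgn x)) * \<bar>?D s\<bar>)) \<partial>lborel)"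
    proof (rule warped_ray_estimate[OF \<phi> C p t _ _ that(2)])
      show "((\<lambda>s. u (s *\<^sub>R sgn x)) has_real_derivative ?D s) (at s)" for s
        by (rule ray_has_real_derivative[OF C_1_differentiable[OF u]])
      show "continuous_on UNIV ?D"
        by (rule continuous_on_compose2[OF C_1_continuous_derivative[OF u]]) (auto intro: continuous_intros)
    qed
    \<comment> \<open>The ray is differentiated in its own direction, whereas \<open>?F\<close> uses
      the radial direction at the point reached; they coincide for \<open>s > 0\<close>.\<close>
    moreover have "sgn (s *\<^sub>R sgn x) = sgn x" if "s > 0" for s :: real
      using that \<open>x \<noteq> 0\<close> by (simp add: sgn_scaleR sgn_div_norm[of "sgn x"] norm_sgn)
    then have "(\<integral>\<^sup>+s. indicator {0<..} s * ennreal (\<phi> \<bar>s\<bar> ^ ?k) * ennreal (p * (powr_weight p (u (s *\<^sub>R sgn x)) * \<bar>?D s\<bar>)) \<partial>lborel)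
        = (\<integral>\<^sup>+s. indicator {0<..} s * ennreal (\<phi> \<bar>s\<bar> ^ ?k) * ?F (s *\<^sub>R sgn x) \<partial>lborel)"
      by (intro nn_integral_cong) (auto simp: indicator_def)
    ultimately show ?thesis by simp
  qed
  have "?c * (ennreal (real CARD('n)) * (\<integral>\<^sup>+x\<in>cball 0 1. ennreal (\<bar>u (t *\<^sub>R sgn x)\<bar> powr p) \<partial>lborel)) =
    ennreal (real CARD('n)) * (\<integral>\<^sup>+x\<in>cball 0 1. ?c * ennreal (\<bar>u (t *\<^sub>R sgn x)\<bar> powr p) \<partial>lborel)"
    by (subst mult.left_commute, subst nn_integral_cmult[symmetric]) (auto simp: mult.assoc)
  also have "\<dots> \<le> ennreal (real CARD('n)) *
    (\<integral>\<^sup>+x\<in>cball 0 1. (\<integral>\<^sup>+s. indicator {0<..} s * ennreal (\<phi> \<bar>s\<bar> ^ ?k) * ?F (s *\<^sub>R sgn x) \<partial>lborel) \<partial>lborel)"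
  proof (intro mult_left_mono nn_integral_mono_AE)
    show "AE x in lborel. ?c * ennreal (\<bar>u (t *\<^sub>R sgn x)\<bar> powr p) * indicator (cball 0 1) x \<le>
      (\<integral>\<^sup>+s. indicator {0<..} s * ennreal (\<phi> \<bar>s\<bar> ^ ?k) * ?F (s *\<^sub>R sgn x) \<partial>lborel) * indicator (cball 0 1) x"
      using fin AE_lborel_singleton[of 0]
      by eventually_elim (use ray in \<open>auto simp: indicator_def\<close>)
  qed simp
  also have "\<dots> = (\<integral>\<^sup>+x. ?F x \<partial>riem_vol \<phi>)"
    by (rule nn_integral_riem_vol_polar[OF \<phi>, symmetric]) measurable
  finally show ?thesis .
qed

text \<open>The radial derivative is a component of the gradient, hence bounded by its metric norm;
  Hoelder then separates the function from the gradient.\<close>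

lemma sphere_mean_le_norms:
  fixes u :: "real ^ 'n \<Rightarrow> real"
  assumes \<phi>: "warping_function \<phi>" and C: "warping_const \<phi> > 0" and p: "p \<ge> 1" and t: "t > 0"
    and u: "u \<in> smooth_W1p \<phi> p"
  shows "(\<integral>\<^sup>+x\<in>cball 0 1. ennreal (\<bar>u (t *\<^sub>R sgn x)\<bar> powr p) \<partial>lborel) \<le>
    ennreal (p * (powr_weight p (Lp_norm \<phi> p u) * Lp_field_norm \<phi> p (riem_grad \<phi> u)) /
      (warping_const \<phi> ^ (CARD('n) - 1) * \<phi> t ^ (CARD('n) - 1) * real CARD('n)))" (is "?E \<le> ennreal (?X / ?c)")
proof -
  let ?g = "\<lambda>x. metric_norm \<phi> x (riem_grad \<phi> u x)"
  have C1: "C_k (Suc 0) u" and um[measurable]: "u \<in> borel_measurable (riem_vol \<phi>)"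
    and up: "integrable (riem_vol \<phi>) (\<lambda>x. \<bar>u x\<bar> powr p)"
    and gp: "integrable (riem_vol \<phi>) (\<lambda>x. ?g x powr p)"
    and gm: "riem_grad \<phi> u \<in> borel_measurable (riem_vol \<phi>)"
    using u unfolding smooth_W1p_def Lp_space_def Lp_fields_def by blast+
  note [measurable] = metric_norm_measurable[OF \<phi> gm]
  have "(\<integral>\<^sup>+x. ennreal (\<bar>u x\<bar> powr p) \<partial>riem_vol \<phi>) \<noteq> \<infinity>"
    using up by (simp add: nn_integral_eq_integral)
  then have "ennreal (warping_const \<phi> ^ (CARD('n) - 1) * \<phi> t ^ (CARD('n) - 1)) * (ennreal (real CARD('n)) * ?E) \<le>
    (\<integral>\<^sup>+x. ennreal (p * (powr_weight p (u x) * \<bar>frechet_derivative u (at x) (sgn x)\<bar>)) \<partial>riem_vol \<phi>)"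
    by (rule sphere_mean_le_nn_integral[OF \<phi> C p t C1])
  also have "\<dots> \<le> (\<integral>\<^sup>+x. ennreal p * ennreal (powr_weight p (u x) * ?g x) \<partial>riem_vol \<phi>)"
  proof (intro nn_integral_mono_AE)
    have "AE x in riem_vol \<phi>. x \<noteq> (0 :: real ^ 'n)"
      by (simp add: AE_riem_vol_iff[OF \<phi>] AE_lborel_singleton)
    then show "AE x in riem_vol \<phi>. ennreal (p * (powr_weight p (u x) * \<bar>frechet_derivative u (at x) (sgn x)\<bar>)) \<le>
      ennreal p * ennreal (powr_weight p (u x) * ?g x)"
    proof (rule eventually_mono)
      fix x :: "real ^ 'n" assume x: "x \<noteq> 0"
      have "\<bar>frechet_derivative u (at x) (sgn x)\<bar> \<le> ?g x"
        using metric_norm_ge_radial[OF \<phi> x] riem_grad_inner_sgn[OF \<phi> x C_1_differentiable[OF C1]] by metis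
      then show "ennreal (p * (powr_weight p (u x) * \<bar>frechet_derivative u (at x) (sgn x)\<bar>)) \<le>
        ennreal p * ennreal (powr_weight p (u x) * ?g x)"
        using p by (simp add: powr_weight_nonneg metric_norm_nonneg[OF \<phi>] mult_left_mono flip: ennreal_mult)
    qed
  qed
  also have "\<dots> = ennreal p * (\<integral>\<^sup>+x. ennreal (powr_weight p (u x) * ?g x) \<partial>riem_vol \<phi>)"
    unfolding powr_weight_def by (rule nn_integral_cmult) measurable
  also have "(\<integral>\<^sup>+x. ennreal (powr_weight p (u x) * ?g x) \<partial>riem_vol \<phi>) \<le>
    ennreal (powr_weight p (Lp_norm \<phi> p u) * Lp_field_norm \<phi> p (riem_grad \<phi> u))"
  \<comment> \<open>For \<open>p = 1\<close> the weight is 1 and the integral is the gradient norm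
    itself; Hoelder applies to \<open>p > 1\<close> only.\<close>
  proof (cases "p = 1")
    case True
    then show ?thesis
      using gp by (simp add: powr_weight_def Lp_field_norm_def powr_one' metric_norm_nonneg[OF \<phi>] nn_integral_eq_integral integral_nonneg)
  next
    case False
    then have "p > 1" using p by simp
    from Hoelder_powr[OF this, of "\<lambda>x. \<bar>u x\<bar>" "riem_vol \<phi>" ?g]
    show ?thesis using up gp False
      by (simp add: powr_weight_def Lp_norm_def Lp_field_norm_def metric_norm_nonneg[OF \<phi>])
  qed
  finally have "ennreal ?c * ?E \<le> ennreal ?X"
    using C p warping_pos[OF \<phi> t]
    by (simp add: ennreal_mult' mult.assoc mult_left_mono powr_weight_nonneg)
  moreover have c: "?c > 0" using C warping_pos[OF \<phi> t] by simp
  moreover have "?X \<ge> 0" using p by (simp add: powr_weight_nonneg Lp_field_norm_def)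
  ultimately show ?thesis by (intro ennreal_le_divideI)
qed

section \<open>Passage to the limit\<close>

text \<open>Convergence of the norms to 0 is convergence of \<open>\<bar>f n\<bar> powr p\<close> to
  0 in the space of integrable functions, which yields an almost everywhere convergent
  subsequence.\<close>

lemma tendsto_Lp_norm_AE_subseq:
  fixes f :: "nat \<Rightarrow> real ^ 'n \<Rightarrow> real"
  assumes p: "p \<ge> 1" and int: "\<And>n. integrable (riem_vol \<phi>) (\<lambda>x. \<bar>f n x\<bar> powr p)"
    and lim: "(\<lambda>n. Lp_norm \<phi> p (f n)) \<longlonglongrightarrow> 0"
  obtains r where "strict_mono r" "AE x in riem_vol \<phi>. (\<lambda>n. f (r n) x) \<longlonglongrightarrow> 0"
proof -
  have "(\<lambda>n. Lp_norm \<phi> p (f n) powr p) \<longlonglongrightarrow> 0"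
    using p by (intro tendsto_zero_powrI[where b=p] lim) (auto simp: Lp_norm_def)
  then have "(\<lambda>n. LINT x|riem_vol \<phi>. norm (\<bar>f n x\<bar> powr p)) \<longlonglongrightarrow> 0"
    using p by (simp add: Lp_norm_def powr_powr powr_one')
  from tendsto_L1_AE_subseq[OF int this]
  obtain r where r: "strict_mono r" "AE x in riem_vol \<phi>. (\<lambda>n. \<bar>f (r n) x\<bar> powr p) \<longlonglongrightarrow> 0" by auto
  have "AE x in riem_vol \<phi>. (\<lambda>n. f (r n) x) \<longlonglongrightarrow> 0"
    using r(2)
  proof (rule eventually_mono)
    fix x assume "(\<lambda>n. \<bar>f (r n) x\<bar> powr p) \<longlonglongrightarrow> 0"
    then have "(\<lambda>n. (\<bar>f (r n) x\<bar> powr p) powr (1 / p)) \<longlonglongrightarrow> 0"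
      by (rule tendsto_zero_powrI) (use p in auto)
    then have "(\<lambda>n. \<bar>f (r n) x\<bar>) \<longlonglongrightarrow> 0"
      using p by (simp add: powr_powr powr_one')
    then show "(\<lambda>n. f (r n) x) \<longlonglongrightarrow> 0"
      by (simp add: tendsto_rabs_zero_iff)
  qed
  with r(1) show thesis by (rule that)
qed

lemma Lp_norm_triangle:
  fixes f g :: "real ^ 'n \<Rightarrow> real"
  assumes p: "p \<ge> 1" and f: "f \<in> Lp_space \<phi> p" and g: "g \<in> Lp_space \<phi> p"
  shows "integrable (riem_vol \<phi>) (\<lambda>x. \<bar>f x - g x\<bar> powr p)"
    and "Lp_norm \<phi> p f \<le> Lp_norm \<phi> p (\<lambda>x. f x - g x) + Lp_norm \<phi> p g"
proof -
  have [measurable]: "f \<in> borel_measurable (riem_vol \<phi>)" "g \<in> borel_measurable (riem_vol \<phi>)"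
    and i: "integrable (riem_vol \<phi>) (\<lambda>x. \<bar>f x\<bar> powr p)" "integrable (riem_vol \<phi>) (\<lambda>x. \<bar>g x\<bar> powr p)"
    using f g by (auto simp: Lp_space_def)
  show d: "integrable (riem_vol \<phi>) (\<lambda>x. \<bar>f x - g x\<bar> powr p)"
    by (rule Minkowski_powr(1)[OF p _ i]) auto
  show "Lp_norm \<phi> p f \<le> Lp_norm \<phi> p (\<lambda>x. f x - g x) + Lp_norm \<phi> p g"
    unfolding Lp_norm_def by (rule Minkowski_powr(2)[OF p _ d i(2)]) auto
qed

lemma Lp_field_norm_triangle:
  fixes F G :: "real ^ 'n \<Rightarrow> real ^ 'n"
  assumes \<phi>: "warping_function \<phi>" and p: "p \<ge> 1" and F: "F \<in> Lp_fields \<phi> p" and G: "G \<in> Lp_fields \<phi> p"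
  shows "Lp_field_norm \<phi> p F \<le> Lp_field_norm \<phi> p (\<lambda>x. F x - G x) + Lp_field_norm \<phi> p G"
proof -
  have FG: "F \<in> borel_measurable (riem_vol \<phi>)" "G \<in> borel_measurable (riem_vol \<phi>)"
    and i: "integrable (riem_vol \<phi>) (\<lambda>x. metric_norm \<phi> x (F x) powr p)" "integrable (riem_vol \<phi>) (\<lambda>x. metric_norm \<phi> x (G x) powr p)"
    using F G by (auto simp: Lp_fields_def)
  have "(\<lambda>x. F x - G x) \<in> borel_measurable (riem_vol \<phi>)" using FG by simp
  note m = metric_norm_measurable[OF \<phi> this] metric_norm_measurable[OF \<phi> FG(1)]
  have d: "integrable (riem_vol \<phi>) (\<lambda>x. metric_norm \<phi> x (F x - G x) powr p)"
  proof (rule Minkowski_powr(1)[OF p m(1) i])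
    show "metric_norm \<phi> x (F x - G x) \<le> metric_norm \<phi> x (F x) + metric_norm \<phi> x (G x)" for x
      \<comment> \<open>Subtracting \<open>F x\<close> from \<open>F x - G x\<close> leaves
        \<open>- G x\<close>, so the triangle inequality is used together with symmetry.\<close>
      using metric_norm_triangle[OF \<phi>, of x "F x - G x" "F x"] metric_norm_minus[OF \<phi>, of x "G x"] by simp
  qed (auto simp: metric_norm_nonneg[OF \<phi>])
  show ?thesis
    unfolding Lp_field_norm_def
    by (rule Minkowski_powr(2)[OF p m(2) d i(2)]) (auto simp: metric_norm_nonneg[OF \<phi>] metric_norm_triangle[OF \<phi>])
qed

lemma tendsto_powr_weight:
  assumes "p \<ge> 1" "(f \<longlongrightarrow> a) F"
  shows "((\<lambda>x. powr_weight p (f x)) \<longlongrightarrow> powr_weight p a) F"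
  using continuous_on_tendsto_compose[OF continuous_on_powr_weight[OF assms(1) continuous_on_id, of UNIV] assms(2)] by simp

lemma powr_weight_mono: "p \<ge> 1 \<Longrightarrow> 0 \<le> a \<Longrightarrow> a \<le> b \<Longrightarrow> powr_weight p a \<le> powr_weight p b"
  by (auto simp: powr_weight_def intro: powr_mono2)

text \<open>The bound is kept in \<open>p\<close>-th powers and in the radius: the exceptional radii
  are those spheres on which the approximants fail to converge almost everywhere.\<close>

lemma radial_bound:
  fixes u :: "real ^ 'n \<Rightarrow> real"
  assumes \<phi>: "warping_function \<phi>" and C: "warping_const \<phi> > 0" and p: "p \<ge> 1"
    and v: "\<And>x. x \<noteq> 0 \<Longrightarrow> u x = v (norm x)" and G: "has_W1p_grad \<phi> p u G"
  shows "AE t in lborel. t > 0 \<longrightarrow> \<bar>v t\<bar> powr p \<le>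
    p * (powr_weight p (Lp_norm \<phi> p u) * Lp_field_norm \<phi> p G) /
    (warping_const \<phi> ^ (CARD('n) - 1) * \<phi> t ^ (CARD('n) - 1) * sphere_volume TYPE(real ^ 'n))"
proof -
  obtain U where GL: "G \<in> Lp_fields \<phi> p" and U: "\<And>n. U n \<in> smooth_W1p \<phi> p" and uL: "u \<in> Lp_space \<phi> p"
    and limU: "(\<lambda>n. Lp_norm \<phi> p (\<lambda>x. U n x - u x)) \<longlonglongrightarrow> 0"
    and limG: "(\<lambda>n. Lp_field_norm \<phi> p (\<lambda>x. riem_grad \<phi> (U n) x - G x)) \<longlonglongrightarrow> 0"
    using G unfolding has_W1p_grad_def W1p_represents_def by blast
  have UL: "U n \<in> Lp_space \<phi> p" "riem_grad \<phi> (U n) \<in> Lp_fields \<phi> p" "C_k (Suc 0) (U n)" for n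
    using U[of n] unfolding smooth_W1p_def by blast+
  have [measurable]: "U n \<in> borel_measurable borel" for n
    using C_1_continuous[OF UL(3)] by (rule borel_measurable_continuous_onI)
  obtain r where r: "strict_mono r" "AE x in riem_vol \<phi>. (\<lambda>n. U (r n) x - u x) \<longlonglongrightarrow> 0"
    by (rule tendsto_Lp_norm_AE_subseq[OF p Lp_norm_triangle(1)[OF p UL(1) uL] limU])
  have "AE x in lborel. (\<lambda>n. U (r n) x - u x) \<longlonglongrightarrow> 0"
    using r(2) by (simp add: AE_riem_vol_iff[OF \<phi>])
  note sphere = AE_sphere_of_AE[OF this]
  have bound: "\<bar>v t\<bar> powr p \<le> p * (powr_weight p (Lp_norm \<phi> p u) * Lp_field_norm \<phi> p G) /
      (warping_const \<phi> ^ (CARD('n) - 1) * \<phi> t ^ (CARD('n) - 1) * sphere_volume TYPE(real ^ 'n))"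
    if t: "t > 0" and ae: "AE x in lborel. x \<in> cball 0 1 \<longrightarrow> (\<lambda>n. U (r n) (t *\<^sub>R sgn x) - u (t *\<^sub>R sgn x)) \<longlonglongrightarrow> 0" for t
  proof -
    define c where "c = warping_const \<phi> ^ (CARD('n) - 1) * \<phi> t ^ (CARD('n) - 1) * real CARD('n)"
    have c: "c > 0" using C warping_pos[OF \<phi> t] by (simp add: c_def)
    define A where "A n = Lp_norm \<phi> p (\<lambda>x. U n x - u x) + Lp_norm \<phi> p u" for n
    define B where "B n = Lp_field_norm \<phi> p (\<lambda>x. riem_grad \<phi> (U n) x - G x) + Lp_field_norm \<phi> p G" for n
    define K where "K n = p * (powr_weight p (A n) * B n) / c" for n
    define K' where "K' = p * (powr_weight p (Lp_norm \<phi> p u) * Lp_field_norm \<phi> p G) / c"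
    define V where "V = measure lborel (cball (0 :: real ^ 'n) 1)"
    have V: "V > 0" "emeasure lborel (cball (0 :: real ^ 'n) 1) = ennreal V"
      using content_cball_pos[of 1 "0 :: real ^ 'n"] emeasure_lborel_cball_finite[of "0 :: real ^ 'n" 1]
      by (auto simp: V_def emeasure_eq_ennreal_measure)
    have "A \<longlonglongrightarrow> 0 + Lp_norm \<phi> p u" "B \<longlonglongrightarrow> 0 + Lp_field_norm \<phi> p G"
      unfolding A_def[abs_def] B_def[abs_def] by (intro tendsto_add limU limG tendsto_const)+
    then have "K \<longlonglongrightarrow> K'"
      unfolding K_def[abs_def] K'_def using c by (intro tendsto_intros tendsto_powr_weight p) auto
    then have "(\<lambda>n. ennreal (K (r n))) \<longlonglongrightarrow> ennreal K'"
      using LIMSEQ_subseq_LIMSEQ[OF _ r(1)] by (intro tendsto_ennrealI) (simp add: o_def)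
    then have limK: "liminf (\<lambda>n. ennreal (K (r n))) = ennreal K'"
      by (rule lim_imp_Liminf[rotated]) simp
    have E: "(\<integral>\<^sup>+x\<in>cball 0 1. ennreal (\<bar>U n (t *\<^sub>R sgn x)\<bar> powr p) \<partial>lborel) \<le> ennreal (K n)" for n
    proof -
      have "p * (powr_weight p (Lp_norm \<phi> p (U n)) * Lp_field_norm \<phi> p (riem_grad \<phi> (U n))) / c \<le> K n"
        unfolding K_def A_def B_def using c p
        by (intro divide_right_mono mult_left_mono mult_mono powr_weight_mono Lp_norm_triangle(2)[OF p UL(1) uL]
            Lp_field_norm_triangle[OF \<phi> p UL(2) GL])
          (auto simp: powr_weight_nonneg Lp_norm_def Lp_field_norm_def)
      then show ?thesis
        using sphere_mean_le_norms[OF \<phi> C p t U[of n]] unfolding c_def[symmetric]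
        by (meson ennreal_leI order_trans)
    qed
    have pointwise: "ennreal (\<bar>v t\<bar> powr p) * indicator (cball 0 1) x \<le>
        liminf (\<lambda>n. ennreal (\<bar>U (r n) (t *\<^sub>R sgn x)\<bar> powr p) * indicator (cball 0 1) x)"
      if x: "x \<noteq> 0" and lim: "x \<in> cball 0 1 \<longrightarrow> (\<lambda>n. U (r n) (t *\<^sub>R sgn x) - u (t *\<^sub>R sgn x)) \<longlonglongrightarrow> 0" for x
    proof (cases "x \<in> cball 0 1")
      case True
      \<comment> \<open>Radiality enters here: the limit on the sphere of radius \<open>t\<close> is
        the single value \<open>v t\<close>, although the \<open>U n\<close> may depend on the
        direction.\<close>
      have "u (t *\<^sub>R sgn x) = v t"
        using v[of "t *\<^sub>R sgn x"] x t by (simp add: norm_sgn sgn_zero_iff)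
      then have "(\<lambda>n. U (r n) (t *\<^sub>R sgn x)) \<longlonglongrightarrow> v t"
        using lim True LIM_zero_cancel[of "\<lambda>n. U (r n) (t *\<^sub>R sgn x)" "v t"] by simp
      from tendsto_rabs[OF this]
      have "(\<lambda>n. \<bar>U (r n) (t *\<^sub>R sgn x)\<bar> powr p) \<longlonglongrightarrow> \<bar>v t\<bar> powr p"
        by (rule tendsto_powr'[OF _ tendsto_const]) (use p in auto)
      then have "(\<lambda>n. ennreal (\<bar>U (r n) (t *\<^sub>R sgn x)\<bar> powr p)) \<longlonglongrightarrow> ennreal (\<bar>v t\<bar> powr p)"
        by (rule tendsto_ennrealI)
      from lim_imp_Liminf[OF _ this]
      show ?thesis using True by simp
    qed simp
    \<comment> \<open>Integrating a constant over the directions gives the factor \<open>V\<close>;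
      times the dimension contained in \<open>c\<close> it becomes the sphere volume.\<close>
    have "ennreal (\<bar>v t\<bar> powr p) * ennreal V = (\<integral>\<^sup>+x\<in>cball (0 :: real ^ 'n) 1. ennreal (\<bar>v t\<bar> powr p) \<partial>lborel)"
      by (subst nn_integral_cmult_indicator) (auto simp: V)
    also have "\<dots> \<le> (\<integral>\<^sup>+x. liminf (\<lambda>n. ennreal (\<bar>U (r n) (t *\<^sub>R sgn x)\<bar> powr p) * indicator (cball 0 1) x) \<partial>lborel)"
      by (rule nn_integral_mono_AE, rule AE_mp[OF ae], rule AE_mp[OF AE_lborel_singleton[of 0]])
         (use pointwise in simp)
    \<comment> \<open>Fatou's lemma on the sphere of radius \<open>t\<close>.\<close>
    also have "\<dots> \<le> liminf (\<lambda>n. \<integral>\<^sup>+x\<in>cball 0 1. ennreal (\<bar>U (r n) (t *\<^sub>R sgn x)\<bar> powr p) \<partial>lborel)"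
      by (rule nn_integral_liminf) measurable
    also have "\<dots> \<le> liminf (\<lambda>n. ennreal (K (r n)))"
      by (intro Liminf_mono always_eventually allI E)
    finally have "ennreal (\<bar>v t\<bar> powr p * V) \<le> ennreal K'"
      unfolding limK using V(1) by (simp add: ennreal_mult)
    moreover have "K' \<ge> 0"
      using c p by (simp add: K'_def powr_weight_nonneg Lp_field_norm_def)
    ultimately have "\<bar>v t\<bar> powr p \<le> K' / V"
      using V(1) by (simp add: pos_le_divide_eq)
    then show "\<bar>v t\<bar> powr p \<le> p * (powr_weight p (Lp_norm \<phi> p u) * Lp_field_norm \<phi> p G) /
      (warping_const \<phi> ^ (CARD('n) - 1) * \<phi> t ^ (CARD('n) - 1) * sphere_volume TYPE(real ^ 'n))"
      by (simp add: K'_def c_def V_def sphere_volume_eq mult.assoc)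
  qed
  show ?thesis
    by (rule eventually_mono[OF sphere]) (use bound in blast)
qed

section \<open>From radii to points, and the \<open>p\<close>-th root\<close>

theorem lemma6p2:
  fixes \<phi> :: "real \<Rightarrow> real" and p :: real
    and u :: "real ^ 'n \<Rightarrow> real" and G :: "real ^ 'n \<Rightarrow> real ^ 'n"
  assumes "CARD('n) \<ge> 2"
    and "warping_function \<phi>"
    and "p \<ge> 1"
    and "warping_const \<phi> > 0"
    and "u \<in> W1p_rad \<phi> p"
    and "has_W1p_grad \<phi> p u G"
  shows "AE x in riem_vol \<phi>.
    \<bar>u x\<bar> \<le>
      (p / (warping_const \<phi> ^ (CARD('n) - 1) * sphere_volume TYPE(real ^ 'n))) powr (1 / p)
      * (if p = 1 then 1 else Lp_norm \<phi> p u powr ((p - 1) / p))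
      * Lp_field_norm \<phi> p G powr (1 / p)
      * \<phi> (norm x) powr ((1 - real CARD('n)) / p)"
proof -
  let ?A = "Lp_norm \<phi> p u" and ?B = "Lp_field_norm \<phi> p G" and ?c = "warping_const \<phi> ^ (CARD('n) - 1)"
  let ?w = "sphere_volume TYPE(real ^ 'n)"
  obtain v where v: "\<And>x. x \<noteq> 0 \<Longrightarrow> u x = v (norm x)"
    using assms(5) by (auto simp: W1p_rad_def radial_def)
  have "AE x in (lborel :: (real ^ 'n) measure). norm x > 0 \<longrightarrow> \<bar>v (norm x)\<bar> powr p \<le>
      p * (powr_weight p ?A * ?B) / (?c * \<phi> (norm x) ^ (CARD('n) - 1) * ?w)"
    by (rule AE_norm_of_AE[OF radial_bound[OF assms(2,4,3) v assms(6)]])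
  then have "AE x in lborel. \<bar>u x\<bar> \<le> (p / (?c * ?w)) powr (1 / p)
      * (if p = 1 then 1 else ?A powr ((p - 1) / p)) * ?B powr (1 / p)
      * \<phi> (norm x) powr ((1 - real CARD('n)) / p)"
    using AE_lborel_singleton[of 0]
  proof eventually_elim
    case (elim x)
    have \<phi>: "\<phi> (norm x) > 0" using elim(2) warping_pos[OF assms(2)] by simp
    have inv: "1 / \<phi> (norm x) ^ (CARD('n) - 1) = \<phi> (norm x) powr (1 - real CARD('n))"
    proof -
      have "\<phi> (norm x) ^ (CARD('n) - 1) = \<phi> (norm x) powr (real CARD('n) - 1)"
        using \<phi> by (simp add: powr_realpow[symmetric] of_nat_diff)
      then show ?thesis by (simp add: powr_minus_divide[symmetric])
    qed
    \<comment> \<open>For \<open>p = 1\<close> both sides are 1 even if the norm is 0, where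
      \<open>0 powr 0\<close> would give 0.\<close>
    have weight: "powr_weight p ?A powr (1 / p) = (if p = 1 then 1 else ?A powr ((p - 1) / p))"
      by (simp add: powr_weight_def powr_powr Lp_norm_def)
    have "\<bar>u x\<bar> = (\<bar>u x\<bar> powr p) powr (1 / p)"
      using assms(3) by (simp add: powr_powr powr_one')
    also have "\<dots> \<le> (p * (powr_weight p ?A * ?B) / (?c * \<phi> (norm x) ^ (CARD('n) - 1) * ?w)) powr (1 / p)"
      using elim v assms(3) by (intro powr_mono2) auto
    also have "p * (powr_weight p ?A * ?B) / (?c * \<phi> (norm x) ^ (CARD('n) - 1) * ?w) =
        (p / (?c * ?w)) * powr_weight p ?A * ?B * (1 / \<phi> (norm x) ^ (CARD('n) - 1))"
      by (simp add: field_simps)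
    also have "\<dots> powr (1 / p) = (p / (?c * ?w)) powr (1 / p) * powr_weight p ?A powr (1 / p) * ?B powr (1 / p)
        * \<phi> (norm x) powr ((1 - real CARD('n)) / p)"
      unfolding inv by (simp only: powr_mult powr_powr times_divide_eq_right mult_1_right)
    finally show ?case unfolding weight .
  qed
  then show ?thesis by (simp add: AE_riem_vol_iff[OF assms(2)])
qed

end
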